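(* Let $A$ be a $\Delta^0_2$ set such that $A\not\leq_K\emptyset$. Then there exists a nonempty $\Pi^0_1$ class $\mathcal{P}\subseteq 2^{\omega}$ such that every $X\in\mathcal{P}$ satisfies $X\not\leq_K\emptyset$ and $A\not\leq_K X$.
   Context: Sets are identified with their binary characteristic sequences (elements of $2^\omega$); $X\restriction_n$ is the string of the first $n$ bits of $X$. $K$ denotes prefix-free Kolmogorov complexity with respect to a fixed optimal prefix-free machine. For sets $X,Y$, $X\leq_K Y$ means there is a constant $c$ with $K(X\restriction_n)\leq K(Y\restriction_n)+c$ for all $n$; thus $X\leq_K\emptyset$ means $X$ is $K$-trivial, i.e. $K(X\restriction_n)\leq K(n)+c$ for some $c$ and all $n$. A $\Pi^0_1$ class is the set of infinite paths through a computable binary tree. *)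

theory Defs
  imports Main "HOL-Library.Nat_Bijection" "HOL-Library.Sublist"
begin

datatype recf =
    Zero | Succ | Fst | Snd
  | Pair recf recf
  | Comp recf recf
  | Rec recf recf
  | Mn recf

inductive eval :: "recf \<Rightarrow> nat \<Rightarrow> nat \<Rightarrow> bool" where
  "eval Zero x 0"
| "eval Succ x (Suc x)"
| "eval Fst x (fst (prod_decode x))"
| "eval Snd x (snd (prod_decode x))"
| "eval f x y \<Longrightarrow> eval g x z \<Longrightarrow> eval (Pair f g) x (prod_encode (y, z))"
| "eval g x y \<Longrightarrow> eval f y z \<Longrightarrow> eval (Comp f g) x z"
| "eval f x y \<Longrightarrow> eval (Rec f g) (prod_encode (x, 0)) y"
| "eval (Rec f g) (prod_encode (x, n)) y \<Longrightarrow>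
   eval g (prod_encode (x, prod_encode (n, y))) z \<Longrightarrow>
   eval (Rec f g) (prod_encode (x, Suc n)) z"
| "eval f (prod_encode (x, n)) 0 \<Longrightarrow>
   (\<forall>m<n. \<exists>k. eval f (prod_encode (x, m)) (Suc k)) \<Longrightarrow>
   eval (Mn f) x n"

type_synonym bstr = "bool list"

definition code :: "bstr \<Rightarrow> nat" where
  "code \<sigma> = list_encode (map (\<lambda>b. if b then 1 else 0) \<sigma>)"

definition restr :: "(nat \<Rightarrow> bool) \<Rightarrow> nat \<Rightarrow> bstr" where
  "restr X n = map X [0..<n]"

definition partial_computable_str :: "(bstr \<Rightarrow> bstr option) \<Rightarrow> bool" where
  "partial_computable_str M \<longleftrightarrow>
     (\<exists>e. \<forall>\<sigma> \<tau>. M \<sigma> = Some \<tau> \<longleftrightarrow> eval e (code \<sigma>) (code \<tau>))"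

definition computable_str_set :: "bstr set \<Rightarrow> bool" where
  "computable_str_set T \<longleftrightarrow>
     (\<exists>e. \<forall>\<sigma>. eval e (code \<sigma>) (if \<sigma> \<in> T then 1 else 0))"

definition computable_rel3 :: "(nat \<Rightarrow> nat \<Rightarrow> nat \<Rightarrow> bool) \<Rightarrow> bool" where
  "computable_rel3 R \<longleftrightarrow>
     (\<exists>e. \<forall>n x y. eval e (prod_encode (n, prod_encode (x, y))) (if R n x y then 1 else 0))"

definition Sigma02 :: "(nat \<Rightarrow> bool) \<Rightarrow> bool" where
  "Sigma02 A \<longleftrightarrow> (\<exists>R. computable_rel3 R \<and> (\<forall>n. A n \<longleftrightarrow> (\<exists>x. \<forall>y. R n x y)))"

definition Pi02 :: "(nat \<Rightarrow> bool) \<Rightarrow> bool" where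
  "Pi02 A \<longleftrightarrow> Sigma02 (\<lambda>n. \<not> A n)"

definition Delta02 :: "(nat \<Rightarrow> bool) \<Rightarrow> bool" where
  "Delta02 A \<longleftrightarrow> Sigma02 A \<and> Pi02 A"

definition is_tree :: "bstr set \<Rightarrow> bool" where
  "is_tree T \<longleftrightarrow> (\<forall>\<sigma> \<tau>. \<tau> \<in> T \<longrightarrow> prefix \<sigma> \<tau> \<longrightarrow> \<sigma> \<in> T)"

definition paths :: "bstr set \<Rightarrow> (nat \<Rightarrow> bool) set" where
  "paths T = {X. \<forall>n. restr X n \<in> T}"

definition Pi01_class :: "(nat \<Rightarrow> bool) set \<Rightarrow> bool" where
  "Pi01_class P \<longleftrightarrow> (\<exists>T. is_tree T \<and> computable_str_set T \<and> P = paths T)"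

definition prefix_free_machine :: "(bstr \<Rightarrow> bstr option) \<Rightarrow> bool" where
  "prefix_free_machine M \<longleftrightarrow> partial_computable_str M \<and>
     (\<forall>\<sigma> \<sigma>'. \<sigma> \<in> dom M \<longrightarrow> \<sigma>' \<in> dom M \<longrightarrow> prefix \<sigma> \<sigma>' \<longrightarrow> \<sigma> = \<sigma>')"

definition optimal_pf_machine :: "(bstr \<Rightarrow> bstr option) \<Rightarrow> bool" where
  "optimal_pf_machine U \<longleftrightarrow> prefix_free_machine U \<and>
     (\<forall>M. prefix_free_machine M \<longrightarrow>
        (\<exists>c. \<forall>\<sigma> \<tau>. M \<sigma> = Some \<tau> \<longrightarrow>
              (\<exists>\<sigma>'. U \<sigma>' = Some \<tau> \<and> length \<sigma>' \<le> length \<sigma> + c)))"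

definition KC :: "(bstr \<Rightarrow> bstr option) \<Rightarrow> bstr \<Rightarrow> nat" where
  "KC U \<tau> = (LEAST l. \<exists>\<sigma>. U \<sigma> = Some \<tau> \<and> length \<sigma> = l)"

definition leK :: "(bstr \<Rightarrow> bstr option) \<Rightarrow> (nat \<Rightarrow> bool) \<Rightarrow> (nat \<Rightarrow> bool) \<Rightarrow> bool" where
  "leK U X Y \<longleftrightarrow> (\<exists>c. \<forall>n. KC U (restr X n) \<le> KC U (restr Y n) + c)"

definition empty_set_seq :: "nat \<Rightarrow> bool" where
  "empty_set_seq = (\<lambda>_. False)"

end

theory Submission
  imports Defs
begin

text \<open>The paths consist of blocks \<open>[i\<^sup>2, (i + 1)\<^sup>2)\<close>, active or frozen. On an active block the path
  is only required to satisfy \<open>K(X\<restriction>(i + 1)\<^sup>2) > 2 i\<close>. As \<open>K((i + 1)\<^sup>2) \<le> i + O(1)\<close>, infinitely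
  many active blocks rule out K-triviality. A prefix
  \<open>\<rho>\<close> ending with an active block \<open>j\<close> determines the path up to the next active block \<open>i\<close>, and a
  machine that knows \<open>\<rho>\<close> finds this continuation, so \<open>K(X\<restriction>n) \<le> K(n) + 2 |\<rho>| + O(1)\<close> for
  \<open>n \<le> i\<^sup>2\<close>. Since \<open>A\<close> is \<open>\<Delta>\<^sup>0\<^sub>2\<close> and not K-trivial, some \<open>n\<close> with
  \<open>K(A\<restriction>n) > K(n) + 2 |\<rho>| + j + O(1)\<close> can be computed in the limit; each change of the guess at a
  stage \<open>r\<close> freezes the blocks \<open>j + 1, \<dots>, r\<close>, so that finally \<open>n \<le> i\<close>.\<close>

section \<open>Computable functions\<close>

text \<open>The two demands on \<open>X\<close> conflict: incompressible blocks raise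
  \<open>K(X|n)\<close> and so make \<open>A \<le>_K X\<close> easier. Frozen stretches resolve
  this, because there \<open>X\<close> carries no information beyond \<open>\<rho>\<close>. A tree
  can only discard strings as the stages go on, so freezing must select an extension that has
  survived so far, and by a rule that can be recomputed from the earlier bits.

  The squares balance two bounds. Block \<open>i\<close> has \<open>2 * i + 1\<close> bits, so
  counting alone yields an extension without programs of length at most \<open>2 * i\<close>,
  whereas naming \<open>(i + 1)^2\<close> by its root in unary costs only \<open>i + O(1)\<close>.

  A requirement whose own block gets frozen is given up, not restarted. Requirement \<open>j\<close>
  demands \<open>j\<close> bits of gap beyond the cost of the coding, so any infinite set of
  surviving requirements defeats every constant.

  \<open>K(n)\<close> can only be approximated from above. The search for a gap therefore measures
  against the length of some program for \<open>0^n\<close>, and the same program is then handed to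
  the machine that reconstructs the path.\<close>

abbreviation pfst :: "nat \<Rightarrow> nat" where "pfst x \<equiv> fst (prod_decode x)"
abbreviation psnd :: "nat \<Rightarrow> nat" where "psnd x \<equiv> snd (prod_decode x)"

definition computable :: "(nat \<Rightarrow> nat) \<Rightarrow> bool" where
  "computable f \<longleftrightarrow> (\<exists>e. \<forall>x. eval e x (f x))"

definition decidable :: "(nat \<Rightarrow> bool) \<Rightarrow> bool" where
  "decidable P \<longleftrightarrow> computable (\<lambda>x. if P x then 1 else 0)"

lemma computable_comp:
  assumes "computable f" "computable g"
  shows "computable (\<lambda>x. f (g x))"
  using assms unfolding computable_def by (meson eval.intros(6))

lemma computable_id: "computable (\<lambda>x. x)"
proof -
  have "eval (Pair Fst Snd) x x" for x
    using eval.intros(5)[OF eval.intros(3) eval.intros(4)] by (metis prod.collapse prod_decode_inverse)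
  then show ?thesis unfolding computable_def by blast
qed

lemma computable_Suc: "computable f \<Longrightarrow> computable (\<lambda>x. Suc (f x))"
  by (rule computable_comp) (auto simp: computable_def intro: eval.intros)

lemma computable_const: "computable (\<lambda>x. c)"
proof (induction c)
  case 0
  show ?case unfolding computable_def using eval.intros(1) by blast
next
  case (Suc c)
  then show ?case by (rule computable_Suc)
qed

lemma computable_pfst: "computable f \<Longrightarrow> computable (\<lambda>x. pfst (f x))"
  by (rule computable_comp) (auto simp: computable_def intro: eval.intros)

lemma computable_psnd: "computable f \<Longrightarrow> computable (\<lambda>x. psnd (f x))"
  by (rule computable_comp) (auto simp: computable_def intro: eval.intros)

lemma computable_prod_encode:
  "computable f \<Longrightarrow> computable g \<Longrightarrow> computable (\<lambda>x. prod_encode (f x, g x))"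
  unfolding computable_def by (meson eval.intros(5))

text \<open>Binary functions enter as functions of a coded pair; in this form computable arguments
  can be substituted by \<open>intro\<close>.\<close>

lemma computable_comp2:
  assumes "computable (\<lambda>p. F (pfst p) (psnd p))" "computable f" "computable g"
  shows "computable (\<lambda>x. F (f x) (g x))"
  using computable_comp[OF assms(1) computable_prod_encode[OF assms(2,3)]] by simp

lemma computable_rec_nat:
  assumes "computable a" "computable (\<lambda>p. g (pfst p) (pfst (psnd p)) (psnd (psnd p)))" "computable m"
  shows "computable (\<lambda>x. rec_nat (a x) (g x) (m x))"
proof -
  from assms obtain ea eg em where
    ea: "\<And>x. eval ea x (a x)" and
    eg: "\<And>p. eval eg p (g (pfst p) (pfst (psnd p)) (psnd (psnd p)))" and
    em: "\<And>x. eval em x (m x)"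
    unfolding computable_def by blast
  have "eval (Rec ea eg) (prod_encode (x, n)) (rec_nat (a x) (g x) n)" for x n
  proof (induction n)
    case 0
    then show ?case using ea by (auto intro: eval.intros)
  next
    case (Suc n)
    then show ?case
      using eg[of "prod_encode (x, prod_encode (n, rec_nat (a x) (g x) n))"] by (auto intro: eval.intros)
  qed
  then have "computable (\<lambda>p. rec_nat (a (pfst p)) (g (pfst p)) (psnd p))"
    unfolding computable_def by (metis prod.collapse prod_decode_inverse)
  from computable_comp2[OF this computable_id assms(3)] show ?thesis .
qed

lemmas computable_base = computable_id computable_Suc computable_const computable_pfst computable_psnd
  computable_prod_encode

lemma computable_add:
  assumes "computable f" "computable g" shows "computable (\<lambda>x. f x + g x)"
proof -
  have "rec_nat a (\<lambda>_ r. Suc r) b = a + b" for a b by (induction b) auto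
  moreover have "computable (\<lambda>x. rec_nat (f x) (\<lambda>_ r. Suc r) (g x))"
    by (intro computable_rec_nat computable_base assms)
  ultimately show ?thesis by simp
qed

lemma computable_mult:
  assumes "computable f" "computable g" shows "computable (\<lambda>x. f x * g x)"
proof -
  have "rec_nat 0 (\<lambda>_ r. r + a) b = a * b" for a b :: nat by (induction b) auto
  moreover have "computable (\<lambda>x. rec_nat 0 (\<lambda>_ r. r + f x) (g x))"
    by (intro computable_rec_nat computable_add computable_base computable_comp[OF assms(1)] assms(2))
  ultimately show ?thesis by simp
qed

lemma computable_pred:
  assumes "computable f" shows "computable (\<lambda>x. f x - Suc 0)"
proof -
  have "rec_nat 0 (\<lambda>n r. n) b = b - Suc 0" for b :: nat by (cases b) auto
  moreover have "computable (\<lambda>x. rec_nat 0 (\<lambda>n r. n) (f x))"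
    by (intro computable_rec_nat computable_base assms)
  ultimately show ?thesis by simp
qed

lemma computable_diff:
  assumes "computable f" "computable g" shows "computable (\<lambda>x. f x - g x)"
proof -
  have "rec_nat a (\<lambda>_ r. r - Suc 0) b = a - b" for a b :: nat by (induction b) auto
  moreover have "computable (\<lambda>x. rec_nat (f x) (\<lambda>_ r. r - Suc 0) (g x))"
    by (intro computable_rec_nat computable_pred computable_base assms)
  ultimately show ?thesis by simp
qed

section \<open>Decidable predicates, definition by cases, bounded quantifiers and bounded
  search\<close>

lemma decidable_comp:
  assumes "decidable P" "computable f" shows "decidable (\<lambda>x. P (f x))"
  using computable_comp[OF assms(1)[unfolded decidable_def] assms(2)] unfolding decidable_def .

lemma decidable_comp2:
  assumes "decidable (\<lambda>p. P (pfst p) (psnd p))" "computable f" "computable g"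
  shows "decidable (\<lambda>x. P (f x) (g x))"
  using decidable_comp[OF assms(1) computable_prod_encode[OF assms(2,3)]] by simp

lemma decidable_comp3:
  assumes "decidable (\<lambda>p. P (pfst p) (pfst (psnd p)) (psnd (psnd p)))"
    "computable f" "computable g" "computable h"
  shows "decidable (\<lambda>x. P (f x) (g x) (h x))"
  using decidable_comp[OF assms(1) computable_prod_encode[OF assms(2) computable_prod_encode[OF assms(3,4)]]]
  by simp

lemma computable_if:
  assumes "decidable P" "computable f" "computable g"
  shows "computable (\<lambda>x. if P x then f x else g x)"
proof -
  have "computable (\<lambda>x. rec_nat (g x) (\<lambda>_ _. f x) (if P x then 1 else 0))"
    by (intro computable_rec_nat computable_base assms computable_comp[OF assms(2)]
        assms(1)[unfolded decidable_def])
  moreover have "rec_nat (g x) (\<lambda>_ _. f x) (if P x then 1 else 0) = (if P x then f x else g x)" for x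
    by simp
  ultimately show ?thesis by simp
qed

lemma decidable_const: "decidable (\<lambda>x. b)"
  unfolding decidable_def by (rule computable_const)

lemma decidable_eq_0:
  assumes "computable f" shows "decidable (\<lambda>x. f x = 0)"
proof -
  have "computable (\<lambda>x. 1 - f x)" by (intro computable_diff computable_base assms)
  moreover have "(1 - n) = (if n = 0 then 1 else 0)" for n :: nat by auto
  ultimately show ?thesis unfolding decidable_def by simp
qed

lemma decidable_le:
  assumes "computable f" "computable g" shows "decidable (\<lambda>x. f x \<le> g x)"
  using decidable_eq_0[OF computable_diff[OF assms]] by simp

lemma decidable_less:
  assumes "computable f" "computable g" shows "decidable (\<lambda>x. f x < g x)"
  using decidable_le[OF computable_Suc[OF assms(1)] assms(2)] by (simp add: Suc_le_eq)

lemma decidable_not: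
  assumes "decidable P" shows "decidable (\<lambda>x. \<not> P x)"
proof -
  have "((if P x then 1 else 0) = (0::nat)) = (\<not> P x)" for x by simp
  then show ?thesis using decidable_eq_0[OF assms[unfolded decidable_def]] by (simp only:)
qed

lemma decidable_conj:
  assumes "decidable P" "decidable Q" shows "decidable (\<lambda>x. P x \<and> Q x)"
proof -
  have "computable (\<lambda>x. if P x then if Q x then 1 else 0 else 0)"
    by (intro computable_if computable_const assms)
  moreover have "(if P x then if Q x then 1 else 0 else 0) = (if P x \<and> Q x then 1 else (0::nat))" for x
    by simp
  ultimately show ?thesis unfolding decidable_def by simp
qed

lemma decidable_disj:
  assumes "decidable P" "decidable Q" shows "decidable (\<lambda>x. P x \<or> Q x)"
  using decidable_not[OF decidable_conj[OF decidable_not[OF assms(1)] decidable_not[OF assms(2)]]] by simp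

lemma decidable_imp:
  assumes "decidable P" "decidable Q" shows "decidable (\<lambda>x. P x \<longrightarrow> Q x)"
  unfolding imp_conv_disj by (intro decidable_disj decidable_not assms)

lemma decidable_eq:
  assumes "computable f" "computable g" shows "decidable (\<lambda>x. f x = (g x :: nat))"
proof -
  have "decidable (\<lambda>x. f x \<le> g x \<and> g x \<le> f x)"
    by (intro decidable_conj decidable_le assms)
  moreover have "(f x \<le> g x \<and> g x \<le> f x) = (f x = g x)" for x by auto
  ultimately show ?thesis by (simp only:)
qed

lemma decidable_all_less:
  assumes "decidable (\<lambda>p. P (pfst p) (psnd p))" "computable n"
  shows "decidable (\<lambda>x. \<forall>y<n x. P x y)"
proof -
  have "computable (\<lambda>x. rec_nat 1 (\<lambda>y r. if P x y then r else 0) (n x))"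
    by (intro computable_rec_nat computable_if decidable_comp2[OF assms(1)] computable_base assms(2))
  moreover have "rec_nat 1 (\<lambda>y r. if P x y then r else 0) k = (if \<forall>y<k. P x y then 1 else (0::nat))" for x k
    by (induction k) (auto simp: less_Suc_eq)
  ultimately show ?thesis unfolding decidable_def by simp
qed

lemma decidable_ex_less:
  assumes "decidable (\<lambda>p. P (pfst p) (psnd p))" "computable n"
  shows "decidable (\<lambda>x. \<exists>y<n x. P x y)"
  using decidable_not[OF decidable_all_less[OF decidable_not[OF assms(1)] assms(2)]] by simp

lemma decidable_all_le:
  assumes "decidable (\<lambda>p. P (pfst p) (psnd p))" "computable n"
  shows "decidable (\<lambda>x. \<forall>y\<le>n x. P x y)"
  using decidable_all_less[OF assms(1) computable_Suc[OF assms(2)]] by (simp add: less_Suc_eq_le)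

lemma decidable_ex_le:
  assumes "decidable (\<lambda>p. P (pfst p) (psnd p))" "computable n"
  shows "decidable (\<lambda>x. \<exists>y\<le>n x. P x y)"
  using decidable_ex_less[OF assms(1) computable_Suc[OF assms(2)]] by (simp add: less_Suc_eq_le)

text \<open>The shift by one with \<open>0\<close> for failure has two uses: it is the value
  convention of the bounded evaluation below, and for a set of stages it gives the first stage with
  all hits in the past.\<close>

primrec lastq :: "(nat \<Rightarrow> bool) \<Rightarrow> nat \<Rightarrow> nat" where
  "lastq Q 0 = 0"
| "lastq Q (Suc n) = (if Q n then Suc n else lastq Q n)"

lemma computable_lastq:
  assumes "decidable (\<lambda>p. Q (pfst p) (psnd p))" "computable n"
  shows "computable (\<lambda>x. lastq (Q x) (n x))"
proof -
  have "computable (\<lambda>x. rec_nat 0 (\<lambda>y r. if Q x y then Suc y else r) (n x))"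
    by (intro computable_rec_nat computable_if decidable_comp2[OF assms(1)] computable_base assms(2))
  moreover have "rec_nat 0 (\<lambda>y r. if Q x y then Suc y else r) k = lastq (Q x) k" for x k
    by (induction k) auto
  ultimately show ?thesis by simp
qed

lemma lastq_le: "lastq Q n \<le> n"
  by (induction n) auto

lemma lastq_le_iff: "lastq Q n \<le> i \<longleftrightarrow> (\<forall>r. i \<le> r \<longrightarrow> r < n \<longrightarrow> \<not> Q r)"
proof (induction n)
  case 0
  then show ?case by simp
next
  case (Suc n)
  then show ?case by (auto simp: less_Suc_eq not_less_eq_eq)
qed

lemma lastq_eq_SucD: "lastq Q n = Suc y \<Longrightarrow> y < n \<and> Q y"
  by (induction n) (auto split: if_splits)

lemma lastq_eq_SucI: "y < n \<Longrightarrow> Q y \<Longrightarrow> (\<And>r. y < r \<Longrightarrow> r < n \<Longrightarrow> \<not> Q r) \<Longrightarrow> lastq Q n = Suc y"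
proof (induction n)
  case (Suc n)
  then show ?case by (cases "y = n") (auto simp: less_Suc_eq)
qed simp

lemmas comp_intros = computable_id computable_const computable_Suc computable_pfst computable_psnd
  computable_prod_encode computable_add computable_mult computable_diff computable_if computable_lastq
  decidable_const decidable_eq decidable_le decidable_less decidable_not decidable_conj decidable_disj
  decidable_imp decidable_all_less decidable_ex_less decidable_all_le decidable_ex_le

section \<open>Step-bounded evaluation\<close>

text \<open>The value is shifted by one, with \<open>0\<close> for \<^emph>\<open>no value found with bound \<open>t\<close>\<close>; \<open>t\<close> only
  restricts the range of unbounded searches.\<close>

primrec Ev :: "recf \<Rightarrow> nat \<Rightarrow> nat \<Rightarrow> nat" where
  "Ev Zero x t = 1"
| "Ev Succ x t = Suc (Suc x)"
| "Ev Fst x t = Suc (pfst x)"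
| "Ev Snd x t = Suc (psnd x)"
| "Ev (Pair f g) x t = (if Ev f x t = 0 \<or> Ev g x t = 0 then 0
     else Suc (prod_encode (Ev f x t - 1, Ev g x t - 1)))"
| "Ev (Comp f g) x t = (if Ev g x t = 0 then 0 else Ev f (Ev g x t - 1) t)"
| "Ev (Rec f g) x t = rec_nat (Ev f (pfst x) t)
     (\<lambda>n r. if r = 0 then 0 else Ev g (prod_encode (pfst x, prod_encode (n, r - 1))) t) (psnd x)"
| "Ev (Mn f) x t = lastq (\<lambda>n. Ev f (prod_encode (x, n)) t = 1 \<and>
     (\<forall>m<n. 1 < Ev f (prod_encode (x, m)) t)) t"

lemma computable_Ev: "computable (\<lambda>p. Ev e (pfst p) (psnd p))"
proof (induction e)
  case (Rec f g)
  show ?case unfolding Ev.simps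
    by (intro computable_rec_nat comp_intros computable_comp2[OF Rec(1)] computable_comp2[OF Rec(2)])
next
  case (Pair f g)
  show ?case unfolding Ev.simps by (intro comp_intros Pair)
next
  case (Comp f g)
  show ?case unfolding Ev.simps by (intro comp_intros computable_comp2[OF Comp(1)] Comp)
next
  case (Mn f)
  show ?case unfolding Ev.simps by (intro comp_intros computable_comp2[OF Mn])
qed (unfold Ev.simps, (intro comp_intros)+)

lemma Ev_sound: "Ev e x t = Suc y \<Longrightarrow> eval e x y"
proof (induction e arbitrary: x y)
  case (Pair f g)
  then show ?case by (auto split: if_splits intro!: eval.intros)
next
  case (Comp f g)
  then show ?case by (auto split: if_splits intro!: eval.intros(6)[of g x "Ev g x t - 1"])
next
  case (Rec f g)
  have "rec_nat (Ev f a t) (\<lambda>n r. if r = 0 then 0 else Ev g (prod_encode (a, prod_encode (n, r - 1))) t) b = Suc z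
    \<Longrightarrow> eval (Rec f g) (prod_encode (a, b)) z" for a b z
  proof (induction b arbitrary: z)
    case 0
    then show ?case using Rec.IH(1) by (auto intro: eval.intros)
  next
    case (Suc b)
    let ?r = "rec_nat (Ev f a t) (\<lambda>n r. if r = 0 then 0 else Ev g (prod_encode (a, prod_encode (n, r - 1))) t) b"
    from Suc.prems have "?r \<noteq> 0" and g: "Ev g (prod_encode (a, prod_encode (b, ?r - 1))) t = Suc z"
      by (auto split: if_splits)
    then have "eval (Rec f g) (prod_encode (a, b)) (?r - 1)" by (intro Suc.IH) simp
    then show ?case using Rec.IH(2)[OF g] by (rule eval.intros)
  qed
  from this[of "pfst x" "psnd x" y] Rec.prems show ?case by simp
next
  case (Mn f)
  from lastq_eq_SucD[OF Mn.prems[unfolded Ev.simps]]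
  have y: "Ev f (prod_encode (x, y)) t = Suc 0" "\<forall>m<y. 1 < Ev f (prod_encode (x, m)) t" by auto
  have "\<exists>k. eval f (prod_encode (x, m)) (Suc k)" if "m < y" for m
    using Mn.IH y(2) that by (metis One_nat_def less_imp_Suc_add add_Suc)
  then show ?case using Mn.IH[OF y(1)] by (auto intro: eval.intros)
qed (auto intro: eval.intros)

lemma Ev_mono_Suc: "Ev e x t = Suc y \<Longrightarrow> t \<le> t' \<Longrightarrow> Ev e x t' = Suc y"
proof (induction e arbitrary: x y)
  case (Pair f g)
  then show ?case by (auto split: if_splits simp: gr0_conv_Suc)
next
  case (Comp f g)
  then show ?case by (auto split: if_splits simp: gr0_conv_Suc)
next
  case (Rec f g)
  let ?r = "\<lambda>t. rec_nat (Ev f (pfst x) t) (\<lambda>n r. if r = 0 then 0 else Ev g (prod_encode (pfst x, prod_encode (n, r - 1))) t)"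
  have "?r t b = Suc z \<Longrightarrow> ?r t' b = Suc z" for b z
  proof (induction b arbitrary: z)
    case 0
    then show ?case using Rec.IH(1) Rec.prems by auto
  next
    case (Suc b)
    then obtain w where w: "?r t b = Suc w" by (cases "?r t b") (auto split: if_splits)
    with Suc.prems have "Ev g (prod_encode (pfst x, prod_encode (b, w))) t = Suc z" by simp
    then show ?case using Suc.IH[OF w] Rec.IH(2) Rec.prems by simp
  qed
  then show ?case using Rec.prems by simp
next
  case (Mn f)
  from lastq_eq_SucD[OF Mn.prems(1)[unfolded Ev.simps]]
  have y: "y < t" "Ev f (prod_encode (x, y)) t = Suc 0" "\<forall>m<y. 1 < Ev f (prod_encode (x, m)) t" by auto
  have "1 < Ev f (prod_encode (x, m)) t'" if "m < y" for m
    using Mn.IH y(3) that Mn.prems(2) by (metis One_nat_def less_imp_Suc_add add_Suc)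
  \<comment> \<open>At most one number meets the search condition, because a larger one would need a
    nonzero value of \<open>f\<close> at \<open>y\<close>; hence the last hit is also the least
    zero.\<close>
  then show ?case using Mn.IH[OF y(2)] y(1) Mn.prems(2) unfolding Ev.simps
    by (intro lastq_eq_SucI) auto
qed auto

lemma Ev_Rec_Suc:
  "Ev (Rec f g) (prod_encode (x, Suc n)) t = (if Ev (Rec f g) (prod_encode (x, n)) t = 0 then 0
     else Ev g (prod_encode (x, prod_encode (n, Ev (Rec f g) (prod_encode (x, n)) t - 1))) t)"
  by (simp only: Ev.simps prod_encode_inverse fst_conv snd_conv old.nat.simps(7))

lemma Ev_complete: "eval e x y \<Longrightarrow> \<exists>t. Ev e x t = Suc y"
proof (induction rule: eval.induct)
  case (5 f x y g z)
  then obtain t t' where "Ev f x t = Suc y" "Ev g x t' = Suc z" by blast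
  then have "Ev f x (max t t') = Suc y" "Ev g x (max t t') = Suc z" by (auto intro: Ev_mono_Suc)
  then show ?case by (intro exI[of _ "max t t'"]) simp
next
  case (6 g x y f z)
  then obtain t t' where "Ev g x t = Suc y" "Ev f y t' = Suc z" by blast
  then have "Ev g x (max t t') = Suc y" "Ev f y (max t t') = Suc z" by (auto intro: Ev_mono_Suc)
  then show ?case by (intro exI[of _ "max t t'"]) simp
next
  case (8 f g x n y z)
  then obtain t t' where "Ev (Rec f g) (prod_encode (x, n)) t = Suc y"
    "Ev g (prod_encode (x, prod_encode (n, y))) t' = Suc z" by blast
  then have "Ev (Rec f g) (prod_encode (x, n)) (max t t') = Suc y"
    "Ev g (prod_encode (x, prod_encode (n, y))) (max t t') = Suc z"
    by (auto simp del: Ev.simps intro: Ev_mono_Suc)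
  then show ?case by (intro exI[of _ "max t t'"]) (simp add: Ev_Rec_Suc del: Ev.simps)
next
  case (9 f x n)
  then obtain t where t: "Ev f (prod_encode (x, n)) t = Suc 0" by blast
  from 9 have "\<forall>m. \<exists>t. m < n \<longrightarrow> (\<exists>k. Ev f (prod_encode (x, m)) t = Suc (Suc k))" by blast
  then obtain T where T: "\<And>m. m < n \<Longrightarrow> \<exists>k. Ev f (prod_encode (x, m)) (T m) = Suc (Suc k)" by metis
  \<comment> \<open>The sum dominates every \<open>T m\<close>, and \<open>Suc\<close> puts
    \<open>n\<close> strictly below the search bound.\<close>
  define u where "u = Suc (n + t + sum T {..<n})"
  have 1: "Ev f (prod_encode (x, n)) u = Suc 0" using t by (rule Ev_mono_Suc) (simp add: u_def)
  have 2: "1 < Ev f (prod_encode (x, m)) u" if "m < n" for m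
  proof -
    have "T m \<le> u" using member_le_sum[of m "{..<n}" T] that by (simp add: u_def)
    with T[OF that] obtain k where "Ev f (prod_encode (x, m)) u = Suc (Suc k)" using Ev_mono_Suc by blast
    then show ?thesis by simp
  qed
  have "Ev (Mn f) x u = Suc n" unfolding Ev.simps
    by (rule lastq_eq_SucI) (use 1 2 in \<open>auto simp: u_def\<close>)
  then show ?case by blast
qed auto

lemma eval_iff_Ev: "eval e x y \<longleftrightarrow> (\<exists>t. Ev e x t = Suc y)"
  using Ev_sound Ev_complete by blast

text \<open>Determinism of the inductive relation is read off from the function \<open>Ev\<close> at
  a common bound.\<close>

lemma eval_functional: "eval e x y \<Longrightarrow> eval e x z \<Longrightarrow> y = z"
proof -
  assume "eval e x y" "eval e x z"
  then obtain t t' where "Ev e x t = Suc y" "Ev e x t' = Suc z" unfolding eval_iff_Ev by blast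
  then have "Ev e x (max t t') = Suc y" "Ev e x (max t t') = Suc z" by (auto intro: Ev_mono_Suc)
  then show "y = z" by simp
qed

section \<open>Computability on strings\<close>

definition lnth :: "nat \<Rightarrow> nat \<Rightarrow> nat" where
  "lnth c k = (if k < length (list_decode c) then list_decode c ! k else 0)"

text \<open>At \<open>0\<close> the truncated subtraction and \<open>prod_decode 0 = (0, 0)\<close>
  give \<open>0\<close> again, the code of \<open>[]\<close>, so iterating past the end is
  harmless.\<close>

lemma list_decode_tl: "list_decode (psnd (c - Suc 0)) = tl (list_decode c)"
proof (cases c)
  case 0
  have "prod_decode 0 = (0, 0)" by (simp add: prod_decode_def prod_decode_aux.simps)
  then show ?thesis using 0 by simp
next
  case (Suc n)
  then show ?thesis by (simp add: case_prod_beta)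
qed

lemma list_decode_drop: "list_decode (rec_nat c (\<lambda>_ r. psnd (r - Suc 0)) k) = drop k (list_decode c)"
  by (induction k) (simp_all add: list_decode_tl drop_Suc tl_drop)

lemma list_decode_eq_Nil_iff: "list_decode c = [] \<longleftrightarrow> c = 0"
  by (cases c) (auto simp: case_prod_beta)

lemma length_list_encode: "length xs \<le> list_encode xs"
proof (induction xs)
  case (Cons a xs)
  then show ?case using le_prod_encode_2[of "list_encode xs" a] by simp
qed simp

lemma length_list_decode: "length (list_decode c) \<le> c"
  using length_list_encode[of "list_decode c"] by simp

lemma computable_lnth:
  assumes "computable f" "computable g" shows "computable (\<lambda>x. lnth (f x) (g x))"
proof -
  have "pfst (c - Suc 0) = (if list_decode c = [] then 0 else hd (list_decode c))" for c
    by (cases c) (auto simp: case_prod_beta prod_decode_def prod_decode_aux.simps)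
  then have "lnth c k = pfst (rec_nat c (\<lambda>_ r. psnd (r - Suc 0)) k - Suc 0)" for c k
    by (simp add: list_decode_drop lnth_def hd_drop_conv_nth)
  moreover have "computable (\<lambda>x. pfst (rec_nat (f x) (\<lambda>_ r. psnd (r - Suc 0)) (g x) - Suc 0))"
    by (intro comp_intros computable_rec_nat assms)
  ultimately show ?thesis by simp
qed

text \<open>Dropping \<open>k\<close> entries leaves a nonempty list exactly when \<open>k\<close>
  is below the length, so the length is a last hit; the code itself bounds the search.\<close>

lemma computable_length_list_decode:
  assumes "computable f" shows "computable (\<lambda>x. length (list_decode (f x)))"
proof -
  have "length (list_decode c) = lastq (\<lambda>k. rec_nat c (\<lambda>_ r. psnd (r - Suc 0)) k \<noteq> 0) c" for c
  proof (cases "length (list_decode c)")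
    case 0
    then have "c = 0" by (simp add: list_decode_eq_Nil_iff)
    then show ?thesis by simp
  next
    case (Suc l)
    have "rec_nat c (\<lambda>_ r. psnd (r - Suc 0)) k \<noteq> 0 \<longleftrightarrow> k < length (list_decode c)" for k
      using list_decode_eq_Nil_iff[of "rec_nat c (\<lambda>_ r. psnd (r - Suc 0)) k"]
      by (auto simp: list_decode_drop)
    then show ?thesis using Suc length_list_decode[of c] lastq_eq_SucI[of l c "\<lambda>k. k < Suc l"] by auto
  qed
  moreover have "computable (\<lambda>x. lastq (\<lambda>k. rec_nat (f x) (\<lambda>_ r. psnd (r - Suc 0)) k \<noteq> 0) (f x))"
    by (intro comp_intros computable_rec_nat assms computable_comp[OF assms])
  ultimately show ?thesis by simp
qed

text \<open>The list is consed from its end: after \<open>k\<close> steps the recursion holds the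
  entries with index in \<open>[n x - k..<n x]\<close>.\<close>

lemma computable_list_encode_map:
  assumes "computable (\<lambda>p. g (pfst p) (psnd p))" "computable n"
  shows "computable (\<lambda>x. list_encode (map (g x) [0..<n x]))"
proof -
  define F where "F = (\<lambda>x. rec_nat 0 (\<lambda>k r. Suc (prod_encode (g x (n x - Suc k), r))))"
  have "k \<le> n x \<Longrightarrow> F x k = list_encode (map (g x) [n x - k..<n x])" for x k
  proof (induction k)
    case (Suc k)
    then have "[n x - Suc k..<n x] = (n x - Suc k) # [n x - k..<n x]"
      by (subst upt_conv_Cons) (auto simp: Suc_diff_Suc)
    with Suc show ?case by (simp add: F_def)
  qed (simp add: F_def)
  then have "F x (n x) = list_encode (map (g x) [0..<n x])" for x by simp
  moreover have "computable (\<lambda>x. F x (n x))" unfolding F_def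
    by (intro comp_intros computable_rec_nat computable_comp2[OF assms(1)] assms(2) computable_comp[OF assms(2)])
  ultimately show ?thesis by simp
qed

text \<open>\<open>str\<close> inverts \<^const>\<open>code\<close> and is total, so that quantifiers over strings become quantifiers
  over numbers.\<close>

definition str :: "nat \<Rightarrow> bstr" where
  "str c = map (\<lambda>n. n \<noteq> 0) (list_decode c)"

lemma str_code [simp]: "str (code \<sigma>) = \<sigma>"
  by (simp add: str_def code_def comp_def)

lemma code_eq_iff [simp]: "code \<sigma> = code \<tau> \<longleftrightarrow> \<sigma> = \<tau>"
  by (metis str_code)

section \<open>Computable operations on bit strings\<close>

definition bit :: "bstr \<Rightarrow> nat \<Rightarrow> bool" where
  "bit \<sigma> k \<longleftrightarrow> k < length \<sigma> \<and> \<sigma> ! k"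

definition scomputable :: "(nat \<Rightarrow> bstr) \<Rightarrow> bool" where
  "scomputable f \<longleftrightarrow> computable (\<lambda>x. code (f x))"

lemma computable_code: "scomputable f \<Longrightarrow> computable (\<lambda>x. code (f x))"
  by (simp add: scomputable_def)

lemma scomputable_comp: "scomputable f \<Longrightarrow> computable g \<Longrightarrow> scomputable (\<lambda>x. f (g x))"
  unfolding scomputable_def by (rule computable_comp)

lemma scomputable_const: "scomputable (\<lambda>x. \<sigma>)"
  unfolding scomputable_def by (rule computable_const)

lemma computable_length:
  assumes "scomputable f" shows "computable (\<lambda>x. length (f x))"
  using computable_length_list_decode[OF computable_code[OF assms]] by (simp add: code_def)

lemma decidable_bit:
  assumes "scomputable f" "computable g" shows "decidable (\<lambda>x. bit (f x) (g x))"
proof -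
  have "bit \<sigma> k \<longleftrightarrow> \<not> lnth (code \<sigma>) k = 0" for \<sigma> k by (simp add: bit_def lnth_def code_def)
  moreover have "decidable (\<lambda>x. \<not> lnth (code (f x)) (g x) = 0)"
    by (intro comp_intros computable_lnth computable_code assms)
  ultimately show ?thesis by simp
qed

lemma decidable_str_eq:
  assumes "scomputable f" "scomputable g" shows "decidable (\<lambda>x. f x = g x)"
  using decidable_eq[OF assms[unfolded scomputable_def]] by simp

lemma scomputable_map_upt:
  assumes "decidable (\<lambda>p. P (pfst p) (psnd p))" "computable n"
  shows "scomputable (\<lambda>x. map (P x) [0..<n x])"
  using computable_list_encode_map[OF assms(1)[unfolded decidable_def] assms(2)]
  by (simp add: scomputable_def code_def comp_def)

lemma scomputable_take:
  assumes "computable n" "scomputable f" shows "scomputable (\<lambda>x. take (n x) (f x))"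
proof -
  have "take k \<sigma> = map (bit \<sigma>) [0..<if k \<le> length \<sigma> then k else length \<sigma>]" for k \<sigma>
    by (rule nth_equalityI) (auto simp: bit_def)
  moreover have "scomputable (\<lambda>x. map (bit (f x)) [0..<if n x \<le> length (f x) then n x else length (f x)])"
    by (intro scomputable_map_upt decidable_bit comp_intros computable_length assms scomputable_comp[OF assms(2)])
  ultimately show ?thesis by simp
qed

lemma scomputable_append:
  assumes "scomputable f" "scomputable g" shows "scomputable (\<lambda>x. f x @ g x)"
proof -
  have "\<sigma> @ \<tau> = map (\<lambda>k. bit \<sigma> k \<or> length \<sigma> \<le> k \<and> bit \<tau> (k - length \<sigma>)) [0..<length \<sigma> + length \<tau>]" for \<sigma> \<tau>
    by (rule nth_equalityI) (auto simp: bit_def nth_append)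
  moreover have "scomputable (\<lambda>x. map (\<lambda>k. bit (f x) k \<or> length (f x) \<le> k \<and> bit (g x) (k - length (f x)))
      [0..<length (f x) + length (g x)])"
    by (intro scomputable_map_upt decidable_bit comp_intros computable_length assms
        scomputable_comp[OF assms(1)] scomputable_comp[OF assms(2)])
  ultimately show ?thesis by simp
qed

lemma scomputable_replicate:
  assumes "computable n" shows "scomputable (\<lambda>x. replicate (n x) b)"
  using scomputable_map_upt[OF decidable_const assms, of b] by (simp add: map_replicate_const)

lemma scomputable_str:
  assumes "computable f" shows "scomputable (\<lambda>x. str (f x))"
proof -
  have "str c = map (\<lambda>k. \<not> lnth c k = 0) [0..<length (list_decode c)]" for c
    by (rule nth_equalityI) (auto simp: str_def lnth_def)
  moreover have "scomputable (\<lambda>x. map (\<lambda>k. \<not> lnth (f x) k = 0) [0..<length (list_decode (f x))])"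
    by (intro scomputable_map_upt comp_intros computable_lnth computable_length_list_decode assms
        computable_comp[OF assms])
  ultimately show ?thesis by simp
qed

text \<open>Among the numbers below the bound, the test \<open>code (str c) = c\<close> keeps
  exactly the codes of strings.\<close>

lemma decidable_all_str:
  assumes "decidable (\<lambda>p. P (pfst p) (str (psnd p)))" "computable n"
  shows "decidable (\<lambda>x. \<forall>\<sigma>. code \<sigma> < n x \<longrightarrow> P x \<sigma>)"
proof -
  have "(\<forall>\<sigma>. code \<sigma> < n x \<longrightarrow> P x \<sigma>) \<longleftrightarrow> (\<forall>c<n x. code (str c) = c \<longrightarrow> P x (str c))" for x
    by (metis str_code)
  moreover have "decidable (\<lambda>x. \<forall>c<n x. code (str c) = c \<longrightarrow> P x (str c))"
    by (intro comp_intros computable_code scomputable_str decidable_comp2[OF assms(1)] assms(2))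
  ultimately show ?thesis by simp
qed

lemma decidable_ex_str:
  assumes "decidable (\<lambda>p. P (pfst p) (str (psnd p)))" "computable n"
  shows "decidable (\<lambda>x. \<exists>\<sigma>. code \<sigma> < n x \<and> P x \<sigma>)"
  using decidable_not[OF decidable_all_str[OF decidable_not[OF assms(1)] assms(2)]] by simp

lemma decidable_str_comp3:
  assumes "decidable (\<lambda>p. P (pfst p) (pfst (psnd p)) (str (psnd (psnd p))))"
    and "computable f" "computable g" "scomputable \<sigma>"
  shows "decidable (\<lambda>x. P (f x) (g x) (\<sigma> x))"
  using decidable_comp3[of "\<lambda>a b c. P a b (str c)", OF assms(1-3) computable_code[OF assms(4)]] by simp

lemmas scomp_intros = comp_intros computable_lnth computable_length computable_code decidable_bit
  decidable_str_eq scomputable_const scomputable_take scomputable_append scomputable_replicate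
  scomputable_str decidable_all_str decidable_ex_str

section \<open>Semidecidable relations and machines\<close>

definition semidecidable :: "(nat \<Rightarrow> bool) \<Rightarrow> bool" where
  "semidecidable P \<longleftrightarrow> (\<exists>Q. decidable (\<lambda>p. Q (pfst p) (psnd p)) \<and> (\<forall>x. P x \<longleftrightarrow> (\<exists>t. Q x t)))"

lemma semidecidable_decidable: "decidable P \<Longrightarrow> semidecidable P"
proof -
  assume "decidable P"
  then have "decidable (\<lambda>p. P (pfst p))" by (rule decidable_comp) (intro comp_intros)
  then show ?thesis unfolding semidecidable_def by (intro exI[of _ "\<lambda>x t. P x"]) simp
qed

lemma semidecidable_ex:
  assumes "semidecidable (\<lambda>p. P (pfst p) (psnd p))"
  shows "semidecidable (\<lambda>x. \<exists>y. P x y)"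
proof -
  from assms obtain Q where Q: "decidable (\<lambda>p. Q (pfst p) (psnd p))"
    "\<And>p. P (pfst p) (psnd p) \<longleftrightarrow> (\<exists>t. Q p t)" unfolding semidecidable_def by blast
  have "decidable (\<lambda>p. Q (prod_encode (pfst p, pfst (psnd p))) (psnd (psnd p)))"
    by (intro decidable_comp2[OF Q(1)] comp_intros)
  moreover have "(\<exists>y. P x y) \<longleftrightarrow> (\<exists>u. Q (prod_encode (x, pfst u)) (psnd u))" for x
    using Q(2)[of "prod_encode (x, y)" for y] by (metis prod_encode_inverse fst_conv snd_conv)
  ultimately show ?thesis unfolding semidecidable_def by (intro exI[of _ "\<lambda>x u. Q (prod_encode (x, pfst u)) (psnd u)"]) simp
qed

lemma semidecidable_ex_str:
  assumes "semidecidable (\<lambda>p. P (pfst p) (str (psnd p)))"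
  shows "semidecidable (\<lambda>x. \<exists>\<sigma>. P x \<sigma>)"
proof -
  have "(\<exists>\<sigma>. P x \<sigma>) \<longleftrightarrow> (\<exists>c. P x (str c))" for x by (metis str_code)
  then show ?thesis using semidecidable_ex[of "\<lambda>x c. P x (str c)"] assms by simp
qed

text \<open>\<open>Mn\<close> searches for a pair of a coded output and a stage confirming it, and a
  second program extracts the output. As \<open>G\<close> is functional, it does not matter which
  confirmed pair is found.\<close>

lemma partial_computable_str_if_semidecidable:
  assumes "semidecidable (\<lambda>p. G (str (pfst p)) (str (psnd p)))"
    and functional: "\<And>\<sigma> \<tau> \<tau>'. G \<sigma> \<tau> \<Longrightarrow> G \<sigma> \<tau>' \<Longrightarrow> \<tau> = \<tau>'"
  shows "\<exists>M. partial_computable_str M \<and> (\<forall>\<sigma> \<tau>. M \<sigma> = Some \<tau> \<longleftrightarrow> G \<sigma> \<tau>)"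
proof -
  from assms(1) obtain Q where Q: "decidable (\<lambda>p. Q (pfst p) (psnd p))"
    "\<And>p. G (str (pfst p)) (str (psnd p)) \<longleftrightarrow> (\<exists>t. Q p t)" unfolding semidecidable_def by blast
  define R where "R = (\<lambda>x u. Q (prod_encode (x, pfst u)) (psnd u))"
  have "decidable (\<lambda>p. R (pfst p) (psnd p))" unfolding R_def
    by (intro decidable_comp2[OF Q(1)] comp_intros)
  then have "computable (\<lambda>p. if R (pfst p) (psnd p) then 0 else 1)"
    by (intro comp_intros)
  then obtain r where r: "\<And>p. eval r p (if R (pfst p) (psnd p) then 0 else 1)"
    unfolding computable_def by blast
  \<comment> \<open>\<open>str\<close> is not injective, so the number found by the search is
    normalised to the code of its string.\<close>
  have "computable (\<lambda>u. code (str (pfst u)))" by (intro scomp_intros)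
  then obtain c where c: "\<And>u. eval c u (code (str (pfst u)))" unfolding computable_def by blast
  define M where "M = (\<lambda>\<sigma>. if \<exists>\<tau>. G \<sigma> \<tau> then Some (THE \<tau>. G \<sigma> \<tau>) else None)"
  have M: "M \<sigma> = Some \<tau> \<longleftrightarrow> G \<sigma> \<tau>" for \<sigma> \<tau>
  proof -
    have "(THE \<tau>. G \<sigma> \<tau>) = \<rho>" if "G \<sigma> \<rho>" for \<rho> using that functional by (intro the_equality)
    then show ?thesis unfolding M_def by auto
  qed
  have RG: "G \<sigma> (str (pfst u))" if "R (code \<sigma>) u" for \<sigma> u
    using that Q(2)[of "prod_encode (code \<sigma>, pfst u)"] unfolding R_def by auto
  have GR: "\<exists>u. R (code \<sigma>) u" if "G \<sigma> \<tau>" for \<sigma> \<tau>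
  proof -
    from that have "G (str (pfst (prod_encode (code \<sigma>, code \<tau>)))) (str (psnd (prod_encode (code \<sigma>, code \<tau>))))"
      by simp
    then obtain t where "Q (prod_encode (code \<sigma>, code \<tau>)) t" using Q(2) by blast
    then have "R (code \<sigma>) (prod_encode (code \<tau>, t))" by (simp add: R_def)
    then show ?thesis ..
  qed
  have mu: "eval (Mn r) x u" if "R x u" "\<And>m. m < u \<Longrightarrow> \<not> R x m" for x u
  proof (rule eval.intros(9))
    show "eval r (prod_encode (x, u)) 0" using r[of "prod_encode (x, u)"] that by simp
    show "\<forall>m<u. \<exists>k. eval r (prod_encode (x, m)) (Suc k)"
    proof (intro allI impI)
      fix m assume "m < u"
      with that(2) show "\<exists>k. eval r (prod_encode (x, m)) (Suc k)" using r[of "prod_encode (x, m)"] by auto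
    qed
  qed
  have eval_G: "G \<sigma> \<tau> \<longleftrightarrow> eval (Comp c (Mn r)) (code \<sigma>) (code \<tau>)" for \<sigma> \<tau>
  proof
    assume G: "G \<sigma> \<tau>"
    define u where "u = (LEAST u. R (code \<sigma>) u)"
    have u: "R (code \<sigma>) u" unfolding u_def using GR[OF G] by (rule LeastI_ex)
    moreover have "\<not> R (code \<sigma>) m" if "m < u" for m
      using that unfolding u_def by (rule not_less_Least)
    ultimately have "eval (Mn r) (code \<sigma>) u" by (rule mu)
    moreover have "str (pfst u) = \<tau>" using functional[OF RG[OF u] G] .
    with c[of u] have "eval c u (code \<tau>)" by simp
    ultimately show "eval (Comp c (Mn r)) (code \<sigma>) (code \<tau>)" by (rule eval.intros(6))
  next
    assume "eval (Comp c (Mn r)) (code \<sigma>) (code \<tau>)"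
    then obtain u where u: "eval (Mn r) (code \<sigma>) u" "eval c u (code \<tau>)" by cases
    from eval_functional[OF u(2) c] have "str (pfst u) = \<tau>" by simp
    moreover from u(1) have "eval r (prod_encode (code \<sigma>, u)) 0" by cases
    from eval_functional[OF this r] have "R (code \<sigma>) u" by (auto split: if_splits)
    ultimately show "G \<sigma> \<tau>" using RG by blast
  qed
  have "partial_computable_str M" unfolding partial_computable_str_def using M eval_G by blast
  with M show ?thesis by blast
qed

section \<open>Blocks and the tree\<close>

text \<open>Block \<open>i\<close> of a sequence is \<open>[i\<^sup>2, (i + 1)\<^sup>2)\<close>. \<open>C j r\<close> means that requirement \<open>j\<close> acts at
  stage \<open>r\<close>; if block \<open>j\<close> is still active then, it deactivates the blocks \<open>i\<close> with \<open>j < i \<le> r\<close>.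
  \<open>reach C s i\<close> bounds the blocks deactivated by stage \<open>s\<close> on behalf of active blocks below \<open>i\<close>.\<close>

primrec reach :: "(nat \<Rightarrow> nat \<Rightarrow> bool) \<Rightarrow> nat \<Rightarrow> nat \<Rightarrow> nat" where
  "reach C s 0 = 0"
| "reach C s (Suc i) = (if reach C s i \<le> i \<and> reach C s i \<le> lastq (C i) s then lastq (C i) s else reach C s i)"

definition active :: "(nat \<Rightarrow> nat \<Rightarrow> bool) \<Rightarrow> nat \<Rightarrow> nat \<Rightarrow> bool" where
  "active C s i \<longleftrightarrow> reach C s i \<le> i"

text \<open>The conditional in \<open>reach\<close> takes a maximum over the active blocks, so an
  upper bound splits into one bound per active block.\<close>

lemma reach_le_iff: "reach C s i \<le> k \<longleftrightarrow> (\<forall>j<i. active C s j \<longrightarrow> lastq (C j) s \<le> k)"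
proof (induction i)
  case (Suc i)
  have "reach C s (Suc i) \<le> k \<longleftrightarrow> reach C s i \<le> k \<and> (active C s i \<longrightarrow> lastq (C i) s \<le> k)"
    by (auto simp: active_def)
  with Suc show ?case by (auto simp: less_Suc_eq)
qed simp

lemma active_iff: "active C s i \<longleftrightarrow> (\<forall>j<i. active C s j \<longrightarrow> lastq (C j) s \<le> i)"
  by (subst active_def) (rule reach_le_iff)

text \<open>Take the least \<open>i > j\<close> beyond all actions of \<open>j\<close>. A block
  strictly in between is hit by some action of \<open>j\<close>, while no active block below
  \<open>i\<close> reaches past \<open>i\<close>.\<close>

lemma next_active:
  assumes j: "\<And>s. active C s j" and fin: "\<exists>r0. \<forall>r\<ge>r0. \<not> C j r"
  shows "\<exists>i>j. (\<forall>s. active C s i) \<and> (\<forall>r\<ge>i. \<not> C j r) \<and>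
    (\<forall>k. j < k \<longrightarrow> k < i \<longrightarrow> (\<exists>s. \<not> active C s k))"
proof -
  from fin obtain r0 where r0: "\<forall>r\<ge>r0. \<not> C j r" ..
  define i where "i = (LEAST i. j < i \<and> (\<forall>r\<ge>i. \<not> C j r))"
  have i: "j < i \<and> (\<forall>r\<ge>i. \<not> C j r)"
    unfolding i_def by (rule LeastI[of _ "max (Suc j) r0"]) (use r0 in auto)
  have min: "\<exists>r\<ge>k. C j r" if "j < k" "k < i" for k
    using not_less_Least[of k "\<lambda>i. j < i \<and> (\<forall>r\<ge>i. \<not> C j r)"] that unfolding i_def by blast
  have inactive: "\<not> active C s k" if "j < k" "k \<le> r" "r < s" "C j r" for k r s
    using that j[of s] unfolding active_iff[of C s k] lastq_le_iff by blast
  have "lastq (C k) s \<le> i" if "k < i" and k: "active C s k" for s k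
  proof -
    consider "k = j" | "k < j" | "j < k" by linarith
    then show ?thesis
    proof cases
      case 1
      then show ?thesis using i by (simp add: lastq_le_iff)
    next
      case 2
      then have "lastq (C k) s \<le> j" using j[of s] k unfolding active_iff[of C s j] by blast
      then show ?thesis using i by simp
    next
      case 3
      then have "j < i - 1" "i - 1 < i" using that by auto
      \<comment> \<open>Minimality of \<open>i\<close> puts an action of \<open>j\<close> exactly at
        stage \<open>i - 1\<close>. It makes \<open>k\<close> inactive at every
        \<open>s \<ge> i\<close>, so \<open>k\<close> is active only for \<open>s < i\<close>, when
        all its past actions lie below \<open>i\<close> as well.\<close>
      from min[OF this] obtain r where "i - 1 \<le> r" "C j r" by blast
      moreover from this i have "r < i" by (meson not_less)
      ultimately have "C j (i - 1)" by (metis Suc_pred' le_antisym less_Suc_eq_le not_less_zero neq0_conv)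
      with inactive[of k "i - 1" s] 3 that have "s \<le> i - 1" by (metis Suc_pred' less_Suc_eq_le not_less_zero neq0_conv not_le)
      then show ?thesis using lastq_le[of "C k" s] by linarith
    qed
  qed
  then have "active C s i" for s unfolding active_iff[of C s i] by blast
  moreover have "\<exists>s. \<not> active C s k" if "j < k" "k < i" for k
    using min[OF that] inactive[OF that(1)] by blast
  ultimately show ?thesis using i by blast
qed

text \<open>Nothing lies below block \<open>0\<close> to deactivate it, and
  \<open>next_active\<close> leads on from there.\<close>

lemma infinite_active:
  assumes "\<And>j. \<exists>r0. \<forall>r\<ge>r0. \<not> C j r"
  shows "\<exists>i\<ge>n. \<forall>s. active C s i"
proof (induction n)
  case 0
  have "active C s 0" for s by (simp add: active_def)
  then show ?case by blast
next
  case (Suc n)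
  then obtain j where j: "n \<le> j" "\<And>s. active C s j" by blast
  from next_active[OF j(2) assms] obtain i where "j < i" "\<forall>s. active C s i" by blast
  with j(1) show ?case by (intro exI[of _ i]) auto
qed

text \<open>In the rest of this section, \<open>V i s \<tau>\<close> means that \<open>\<tau>\<close> is found by stage \<open>s\<close> to be too
  compressible to end with an active block \<open>i\<close>. A deactivated block is frozen to the extension
  of least code that has not been excluded when it is deactivated.\<close>

definition least_ext :: "(nat \<Rightarrow> nat \<Rightarrow> bstr \<Rightarrow> bool) \<Rightarrow> nat \<Rightarrow> nat \<Rightarrow> bstr \<Rightarrow> bool" where
  "least_ext V i d \<tau> \<longleftrightarrow> \<not> V i d \<tau> \<and>
     (\<forall>\<sigma>. code \<sigma> < code \<tau> \<longrightarrow> length \<sigma> = length \<tau> \<and> take (i * i) \<sigma> = take (i * i) \<tau> \<longrightarrow> V i d \<sigma>)"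

definition frozen :: "(nat \<Rightarrow> nat \<Rightarrow> bool) \<Rightarrow> (nat \<Rightarrow> nat \<Rightarrow> bstr \<Rightarrow> bool) \<Rightarrow> nat \<Rightarrow> nat \<Rightarrow> bstr \<Rightarrow> bool" where
  "frozen C V i d \<tau> \<longleftrightarrow> \<not> active C d i \<and> (\<forall>s<d. active C s i) \<and> least_ext V i d \<tau>"

text \<open>A stage imposes a condition only if the block was active at all earlier stages. Thus a
  block is frozen once, at its first inactive stage.\<close>

definition admissible :: "(nat \<Rightarrow> nat \<Rightarrow> bool) \<Rightarrow> (nat \<Rightarrow> nat \<Rightarrow> bstr \<Rightarrow> bool) \<Rightarrow> nat \<Rightarrow> nat \<Rightarrow> bstr \<Rightarrow> bool" where
  "admissible C V i s \<tau> \<longleftrightarrow> ((\<forall>s'<s. active C s' i) \<longrightarrow>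
     (active C s i \<longrightarrow> \<not> V i s \<tau>) \<and> (\<not> active C s i \<longrightarrow> least_ext V i s \<tau>))"

text \<open>The length of the string doubles as the stage, which makes membership a bounded check; a
  node may survive until its extensions are long enough to reveal a violation.\<close>

definition block_tree :: "(nat \<Rightarrow> nat \<Rightarrow> bool) \<Rightarrow> (nat \<Rightarrow> nat \<Rightarrow> bstr \<Rightarrow> bool) \<Rightarrow> bstr set" where
  "block_tree C V = {\<sigma>. \<forall>i<length \<sigma>. \<forall>s\<le>length \<sigma>. Suc i * Suc i \<le> length \<sigma> \<longrightarrow>
     admissible C V i s (take (Suc i * Suc i) \<sigma>)}"

lemma length_restr [simp]: "length (restr X n) = n"
  by (simp add: restr_def)

lemma take_restr: "take m (restr X n) = restr X (min m n)"
  by (simp add: restr_def take_map min_def)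

section \<open>Uniqueness of frozen blocks\<close>

lemma least_ext_unique:
  assumes "least_ext V i d \<sigma>" "least_ext V i d \<tau>" "length \<sigma> = length \<tau>" "take (i * i) \<sigma> = take (i * i) \<tau>"
  shows "\<sigma> = \<tau>"
  using assms unfolding least_ext_def by (metis code_eq_iff linorder_neqE_nat)

text \<open>Both freezing stages are the first inactive one, hence equal, and then the same
  \<open>V i d\<close> decides both strings.\<close>

lemma frozen_unique:
  assumes "frozen C V i d \<sigma>" "frozen C V i d' \<tau>" "length \<sigma> = length \<tau>" "take (i * i) \<sigma> = take (i * i) \<tau>"
  shows "\<sigma> = \<tau>"
proof -
  have "d = d'" using assms(1,2) unfolding frozen_def by (metis linorder_neqE_nat)
  then show ?thesis using assms least_ext_unique unfolding frozen_def by blast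
qed

lemma frozen_exists:
  assumes "\<not> active C s i" "\<And>s. admissible C V i s \<tau>"
  shows "\<exists>d. frozen C V i d \<tau>"
proof -
  define d where "d = (LEAST s. \<not> active C s i)"
  have "\<not> active C d i" unfolding d_def using assms(1) by (rule LeastI)
  moreover have "\<forall>s<d. active C s i"
    using not_less_Least[of _ "\<lambda>s. \<not> active C s i"] unfolding d_def by blast
  ultimately show ?thesis using assms(2)[of d] unfolding frozen_def admissible_def by blast
qed

text \<open>A frozen block depends only on its index and the earlier bits, so agreement propagates
  block by block. The lengths may differ because the strings will be independent guesses of a
  machine.\<close>

lemma frozen_blocks_unique:
  assumes "length \<sigma> = m * m" "length \<tau> = n * n"
    and "\<And>i. j \<le> i \<Longrightarrow> i < m \<Longrightarrow> \<exists>d. frozen C V i d (take (Suc i * Suc i) \<sigma>)"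
    and "\<And>i. j \<le> i \<Longrightarrow> i < n \<Longrightarrow> \<exists>d. frozen C V i d (take (Suc i * Suc i) \<tau>)"
    and "take (j * j) \<sigma> = take (j * j) \<tau>" "j \<le> l" "l \<le> m" "l \<le> n"
  shows "take (l * l) \<sigma> = take (l * l) \<tau>"
  using assms(6-8)
proof (induction l rule: dec_induct)
  case (step i)
  let ?b = "Suc i * Suc i"
  from step have IH: "take (i * i) \<sigma> = take (i * i) \<tau>" by simp
  have le: "?b \<le> m * m" "?b \<le> n * n" using step.prems by (simp_all only: mult_le_mono)
  have "i * i \<le> ?b" by simp
  then have "take (i * i) (take ?b \<sigma>) = take (i * i) (take ?b \<tau>)" using IH by (simp add: min_absorb1)
  moreover have "length (take ?b \<sigma>) = length (take ?b \<tau>)" using le assms(1,2) by simp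
  moreover obtain d d' where "frozen C V i d (take ?b \<sigma>)" "frozen C V i d' (take ?b \<tau>)"
    using assms(3)[of i] assms(4)[of i] step by auto
  ultimately show ?case using frozen_unique by blast
qed (rule assms(5))

section \<open>The tree and its paths\<close>

lemma is_tree_block_tree: "is_tree (block_tree C V)"
  unfolding is_tree_def
proof (intro allI impI)
  fix \<sigma> \<tau> assume "\<tau> \<in> block_tree C V" "prefix \<sigma> \<tau>"
  from this(2) obtain \<rho> where "\<tau> = \<sigma> @ \<rho>" by (auto simp: prefix_def)
  then have "take n \<tau> = take n \<sigma>" if "n \<le> length \<sigma>" for n using that by simp
  moreover have "length \<sigma> \<le> length \<tau>" using \<open>\<tau> = \<sigma> @ \<rho>\<close> by simp
  ultimately show "\<sigma> \<in> block_tree C V" using \<open>\<tau> \<in> block_tree C V\<close>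
    unfolding block_tree_def mem_Collect_eq by (metis le_trans order_less_le_trans)
qed

lemma paths_block_tree:
  "X \<in> paths (block_tree C V) \<longleftrightarrow> (\<forall>i s. admissible C V i s (restr X (Suc i * Suc i)))"
proof
  assume X: "X \<in> paths (block_tree C V)"
  show "\<forall>i s. admissible C V i s (restr X (Suc i * Suc i))"
  proof (intro allI)
    fix i s
    \<comment> \<open>This length exceeds \<open>i\<close> and is at least \<open>s\<close> and the
      end of block \<open>i\<close>, so the node already checks the condition for \<open>i\<close>
      and \<open>s\<close>.\<close>
    have "restr X (Suc i * Suc i + s) \<in> block_tree C V" using X by (simp add: paths_def)
    then have "admissible C V i s (take (Suc i * Suc i) (restr X (Suc i * Suc i + s)))"
      unfolding block_tree_def by simp
    then show "admissible C V i s (restr X (Suc i * Suc i))" by (simp add: take_restr min_absorb1 del: mult_Suc)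
  qed
next
  assume "\<forall>i s. admissible C V i s (restr X (Suc i * Suc i))"
  then show "X \<in> paths (block_tree C V)"
    by (auto simp: paths_def block_tree_def take_restr min_absorb1 simp del: mult_Suc)
qed

text \<open>A path is built block by block. A block that stays active gets an extension that is
  never excluded; one deactivated at stage \<open>d\<close> gets the least extension not excluded at
  \<open>d\<close>, which by monotonicity of \<open>V\<close> was not excluded earlier
  either.\<close>

lemma paths_block_tree_nonempty:
  assumes mono: "\<And>i s s' \<tau>. V i s \<tau> \<Longrightarrow> s \<le> s' \<Longrightarrow> V i s' \<tau>"
    and ext: "\<And>i \<sigma>. length \<sigma> = i * i \<Longrightarrow>
      \<exists>\<tau>. length \<tau> = Suc i * Suc i \<and> take (i * i) \<tau> = \<sigma> \<and> (\<forall>s. \<not> V i s \<tau>)"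
  shows "paths (block_tree C V) \<noteq> {}"
proof -
  have step: "\<exists>\<tau>. length \<tau> = Suc i * Suc i \<and> take (i * i) \<tau> = \<sigma> \<and> (\<forall>s. admissible C V i s \<tau>)"
    if "length \<sigma> = i * i" for i \<sigma>
  proof (cases "\<forall>s. active C s i")
    case True
    then show ?thesis using ext[OF that] by (auto simp: admissible_def)
  next
    case False
    define d where "d = (LEAST s. \<not> active C s i)"
    have d: "\<not> active C d i" unfolding d_def using False LeastI_ex[of "\<lambda>s. \<not> active C s i"] by blast
    have d': "active C s i" if "s < d" for s
      using that not_less_Least[of _ "\<lambda>s. \<not> active C s i"] unfolding d_def by blast
    define Q where "Q = (\<lambda>c. \<exists>\<tau>. code \<tau> = c \<and> length \<tau> = Suc i * Suc i \<and> take (i * i) \<tau> = \<sigma> \<and> \<not> V i d \<tau>)"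
    have "\<exists>c. Q c" using ext[OF that] unfolding Q_def by blast
    then have "Q (LEAST c. Q c)" by (rule LeastI_ex)
    then obtain \<tau> where \<tau>: "code \<tau> = (LEAST c. Q c)" "length \<tau> = Suc i * Suc i" "take (i * i) \<tau> = \<sigma>" "\<not> V i d \<tau>"
      by (subst (asm) (1) Q_def) blast
    have "V i d \<rho>" if "code \<rho> < code \<tau>" "length \<rho> = length \<tau>" "take (i * i) \<rho> = take (i * i) \<tau>" for \<rho>
      using not_less_Least[of "code \<rho>" Q] that \<tau> unfolding Q_def by auto
    then have "least_ext V i d \<tau>" using \<tau>(4) by (simp add: least_ext_def)
    moreover have "\<not> V i s \<tau>" if "s \<le> d" for s using mono[OF _ that] \<tau>(4) by blast
    ultimately have "admissible C V i s \<tau>" for s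
      using d d' unfolding admissible_def by (cases s d rule: linorder_cases) auto
    then show ?thesis using \<tau> by blast
  qed
  have "\<exists>f. \<forall>i. length (f i) = i * i \<and> (take (i * i) (f (Suc i)) = f i \<and> (\<forall>s. admissible C V i s (f (Suc i))))"
    by (rule dependent_nat_choice) (use step in auto)
  then obtain f where f: "\<And>i. length (f i) = i * i" "\<And>i. take (i * i) (f (Suc i)) = f i"
    "\<And>i s. admissible C V i s (f (Suc i))" by blast
  have f_take: "take (i * i) (f (i + k)) = f i" for i k
  proof (induction k)
    case (Suc k)
    have "i * i \<le> (i + k) * (i + k)" by (rule mult_le_mono) auto
    then have "take (i * i) (f (i + Suc k)) = take (i * i) (take ((i + k) * (i + k)) (f (Suc (i + k))))"
      by (simp add: min_absorb1)
    with Suc show ?case by (simp add: f(2))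
  qed (simp add: f(1))
  \<comment> \<open>\<open>f (Suc n)\<close> has length \<open>(n + 1)^2 > n\<close>, so it already
    contains bit \<open>n\<close>.\<close>
  define X where "X = (\<lambda>n. f (Suc n) ! n)"
  have "restr X (i * i) = f i" for i
  proof (rule nth_equalityI)
    fix n assume "n < length (restr X (i * i))"
    then have n: "n < i * i" by simp
    have n': "n < Suc n * Suc n" by simp
    have "f i ! n = f (i + Suc n) ! n" using f_take[of i "Suc n"] n by (metis nth_take)
    also have "\<dots> = f (Suc n) ! n" using f_take[of "Suc n" i] n' by (metis nth_take add.commute)
    finally show "restr X (i * i) ! n = f i ! n" using n by (simp add: restr_def X_def)
  qed (simp add: f(1))
  then have "X \<in> paths (block_tree C V)" unfolding paths_block_tree using f(3) by metis
  then show ?thesis by blast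
qed

section \<open>Computability of the tree\<close>

lemma computable_reach:
  assumes C: "decidable (\<lambda>p. C (pfst p) (psnd p))" and "computable s" "computable i"
  shows "computable (\<lambda>x. reach C (s x) (i x))"
proof -
  have "rec_nat 0 (\<lambda>i r. if r \<le> i \<and> r \<le> lastq (C i) s then lastq (C i) s else r) i = reach C s i" for s i
    by (induction i) auto
  moreover have "computable (\<lambda>x. rec_nat 0 (\<lambda>i r. if r \<le> i \<and> r \<le> lastq (C i) (s x) then lastq (C i) (s x) else r) (i x))"
    by (intro computable_rec_nat comp_intros decidable_comp2[OF C] computable_comp[OF assms(2)] assms)
  ultimately show ?thesis by simp
qed

lemma decidable_active:
  assumes "decidable (\<lambda>p. C (pfst p) (psnd p))" "computable s" "computable i"
  shows "decidable (\<lambda>x. active C (s x) (i x))"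
  unfolding active_def by (intro comp_intros computable_reach assms)

lemma decidable_least_ext:
  assumes V: "decidable (\<lambda>p. V (pfst p) (pfst (psnd p)) (str (psnd (psnd p))))"
    and "computable i" "computable s" "scomputable \<tau>"
  shows "decidable (\<lambda>x. least_ext V (i x) (s x) (\<tau> x))"
  unfolding least_ext_def
  by (intro scomp_intros decidable_str_comp3[OF V] assms(2-) computable_comp[OF assms(2)] computable_comp[OF assms(3)] scomputable_comp[OF assms(4)])

lemma decidable_frozen:
  assumes C: "decidable (\<lambda>p. C (pfst p) (psnd p))"
    and V: "decidable (\<lambda>p. V (pfst p) (pfst (psnd p)) (str (psnd (psnd p))))"
    and "computable i" "computable s" "scomputable \<tau>"
  shows "decidable (\<lambda>x. frozen C V (i x) (s x) (\<tau> x))"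
  unfolding frozen_def
  by (intro scomp_intros decidable_active decidable_least_ext decidable_str_comp3[OF V] C V assms(3-)
      computable_comp[OF assms(3)] computable_comp[OF assms(4)])

lemma decidable_admissible:
  assumes C: "decidable (\<lambda>p. C (pfst p) (psnd p))"
    and V: "decidable (\<lambda>p. V (pfst p) (pfst (psnd p)) (str (psnd (psnd p))))"
    and "computable i" "computable s" "scomputable \<tau>"
  shows "decidable (\<lambda>x. admissible C V (i x) (s x) (\<tau> x))"
  unfolding admissible_def
  by (intro scomp_intros decidable_active decidable_least_ext decidable_str_comp3[OF V] C V assms(3-)
      computable_comp[OF assms(3)] computable_comp[OF assms(4)])

lemma Pi01_class_block_tree:
  assumes C: "decidable (\<lambda>p. C (pfst p) (psnd p))"
    and V: "decidable (\<lambda>p. V (pfst p) (pfst (psnd p)) (str (psnd (psnd p))))"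
  shows "Pi01_class (paths (block_tree C V))"
proof -
  have "decidable (\<lambda>x. str x \<in> block_tree C V)"
    unfolding block_tree_def mem_Collect_eq by (intro scomp_intros decidable_admissible C V)
  then obtain e where e: "\<And>x. eval e x (if str x \<in> block_tree C V then 1 else 0)"
    unfolding decidable_def computable_def by blast
  have "eval e (code \<sigma>) (if \<sigma> \<in> block_tree C V then 1 else 0)" for \<sigma>
    using e[of "code \<sigma>"] by simp
  then have "computable_str_set (block_tree C V)" unfolding computable_str_set_def by blast
  then show ?thesis unfolding Pi01_class_def using is_tree_block_tree by blast
qed

section \<open>Requirements with a convergent witness\<close>

text \<open>Requirement \<open>j\<close> acts at stage \<open>r\<close> if the least \<open>z\<close> such that \<open>W j z\<close> has not been refuted
  changes at \<open>r\<close> or exceeds \<open>r\<close>.\<close>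

definition acts :: "(nat \<Rightarrow> nat \<Rightarrow> nat \<Rightarrow> bool) \<Rightarrow> nat \<Rightarrow> nat \<Rightarrow> bool" where
  "acts W j r \<longleftrightarrow> \<not> (\<exists>z\<le>r. (\<forall>y\<le>r. W j z y) \<and> (\<forall>z'<z. \<exists>y<r. \<not> W j z' y))"

text \<open>Once every candidate below the least true witness \<open>z\<close> has been refuted and
  \<open>r \<ge> z\<close>, this \<open>z\<close> prevents any action.\<close>

lemma acts_finite:
  assumes "\<exists>z. \<forall>y. W j z y"
  shows "\<exists>r0. \<forall>r\<ge>r0. \<not> acts W j r"
proof -
  define z where "z = (LEAST z. \<forall>y. W j z y)"
  have z: "\<forall>y. W j z y" unfolding z_def using assms by (rule LeastI_ex)
  have "\<forall>z'. \<exists>y. z' < z \<longrightarrow> \<not> W j z' y"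
    using not_less_Least[of _ "\<lambda>z. \<forall>y. W j z y"] unfolding z_def by blast
  then obtain f where f: "\<And>z'. z' < z \<Longrightarrow> \<not> W j z' (f z')" by metis
  have f_le: "f z' \<le> sum f {..<z}" if "z' < z" for z' using that by (intro member_le_sum) auto
  show ?thesis
  proof (intro exI allI impI)
    fix r assume "Suc (z + sum f {..<z}) \<le> r"
    then have "z \<le> r" and "\<exists>y<r. \<not> W j z' y" if "z' < z" for z'
      using f[OF that] f_le[OF that] by (auto intro!: exI[of _ "f z'"])
    moreover have "z \<le> r" using \<open>Suc (z + sum f {..<z}) \<le> r\<close> by simp
    ultimately show "\<not> acts W j r" unfolding acts_def using z by blast
  qed
qed

text \<open>A quiet stage \<open>r\<close> names a \<open>z\<close> that is unrefuted through
  \<open>r\<close>, all smaller candidates being refuted before \<open>r\<close>. This overlap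
  forces consecutive quiet stages to name the same \<open>z\<close>, so it is never refuted;
  \<open>z \<le> m\<close> comes from the first of these stages.\<close>

lemma acts_stable:
  assumes quiet: "\<And>r. m \<le> r \<Longrightarrow> \<not> acts W j r"
  shows "\<exists>z\<le>m. \<forall>y. W j z y"
proof -
  have "\<not> acts W j m" using quiet by simp
  then obtain z where z: "z \<le> m" "\<forall>y\<le>m. W j z y" "\<forall>z'<z. \<exists>y<m. \<not> W j z' y"
    unfolding acts_def by blast
  have "\<forall>y\<le>r. W j z y" if "m \<le> r" for r
    using that
  proof (induction r rule: dec_induct)
    case base
    then show ?case using z(2) .
  next
    case (step r)
    have "\<not> acts W j (Suc r)" using quiet step by simp
    then obtain z1 where z1: "\<forall>y\<le>Suc r. W j z1 y" "\<forall>z'<z1. \<exists>y<Suc r. \<not> W j z' y"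
      unfolding acts_def by blast
    have "\<not> z1 < z" using z(3) z1(1) step by (meson le_Suc_eq less_imp_le order.trans)
    moreover have "\<not> z < z1" using z1(2) step by (metis less_Suc_eq_le)
    ultimately have "z1 = z" by simp
    then show ?case using z1(1) by blast
  qed
  then have "W j z y" for y by (meson max.cobounded1 max.cobounded2)
  with z(1) show ?thesis by blast
qed

lemma decidable_acts:
  assumes W: "decidable (\<lambda>p. W (pfst p) (pfst (psnd p)) (psnd (psnd p)))"
  shows "decidable (\<lambda>p. acts W (pfst p) (psnd p))"
  unfolding acts_def by (intro comp_intros decidable_comp3[OF W])

section \<open>Bounded runs of a machine\<close>

definition runs :: "recf \<Rightarrow> nat \<Rightarrow> bstr \<Rightarrow> bstr \<Rightarrow> bool" where
  "runs e t \<sigma> \<tau> \<longleftrightarrow> Ev e (code \<sigma>) t = Suc (code \<tau>)"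

lemma runs_mono: "runs e t \<sigma> \<tau> \<Longrightarrow> t \<le> t' \<Longrightarrow> runs e t' \<sigma> \<tau>"
  unfolding runs_def by (rule Ev_mono_Suc)

lemma decidable_runs:
  assumes "computable t" "scomputable \<sigma>" "scomputable \<tau>"
  shows "decidable (\<lambda>x. runs e (t x) (\<sigma> x) (\<tau> x))"
  unfolding runs_def by (intro scomp_intros computable_comp2[OF computable_Ev] assms)

definition compressed :: "recf \<Rightarrow> nat \<Rightarrow> nat \<Rightarrow> bstr \<Rightarrow> bool" where
  "compressed e i s \<tau> \<longleftrightarrow> (\<exists>\<sigma>. code \<sigma> < s \<and> (length \<sigma> \<le> 2 * i \<and> runs e s \<sigma> \<tau>))"

lemma compressed_mono: "compressed e i s \<tau> \<Longrightarrow> s \<le> s' \<Longrightarrow> compressed e i s' \<tau>"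
  unfolding compressed_def by (meson runs_mono order_less_le_trans)

lemma decidable_compressed:
  assumes "computable i" "computable s" "scomputable \<tau>"
  shows "decidable (\<lambda>x. compressed e (i x) (s x) (\<tau> x))"
  unfolding compressed_def
  by (intro scomp_intros decidable_runs computable_comp[OF assms(1)] computable_comp[OF assms(2)]
      scomputable_comp[OF assms(3)] assms)

text \<open>\<open>z\<close> codes a string \<open>\<sigma>\<close>, a program \<open>\<rho>\<close> with its running time, and \<open>\<Sigma>\<^sup>0\<^sub>2\<close> witnesses for
  \<open>\<sigma>\<close> being an initial segment of the set approximated by \<open>R\<close> and \<open>R'\<close>.\<close>

definition gap_witness :: "recf \<Rightarrow> (nat \<Rightarrow> nat \<Rightarrow> nat \<Rightarrow> bool) \<Rightarrow> (nat \<Rightarrow> nat \<Rightarrow> nat \<Rightarrow> bool) \<Rightarrow>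
    (nat \<Rightarrow> nat) \<Rightarrow> nat \<Rightarrow> nat \<Rightarrow> nat \<Rightarrow> bool" where
  "gap_witness e R R' g j z y \<longleftrightarrow>
     (let \<sigma> = str (pfst z); \<rho> = str (pfst (psnd z)); t = pfst (psnd (psnd z)); x = psnd (psnd (psnd z))
      in runs e t \<rho> (replicate (length \<sigma>) False) \<and>
         (\<forall>k<length \<sigma>. (bit \<sigma> k \<longrightarrow> R k (lnth x k) y) \<and> (\<not> bit \<sigma> k \<longrightarrow> R' k (lnth x k) y)) \<and>
         (\<forall>\<pi>. code \<pi> < y \<longrightarrow> length \<pi> \<le> length \<rho> + g j \<longrightarrow> \<not> runs e y \<pi> \<sigma>))"

lemma decidable_gap_witness:
  assumes R: "decidable (\<lambda>p. R (pfst p) (pfst (psnd p)) (psnd (psnd p)))"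
    and R': "decidable (\<lambda>p. R' (pfst p) (pfst (psnd p)) (psnd (psnd p)))" and g: "computable g"
  shows "decidable (\<lambda>p. gap_witness e R R' g (pfst p) (pfst (psnd p)) (psnd (psnd p)))"
  unfolding gap_witness_def Let_def
  by (intro scomp_intros decidable_runs decidable_comp3[OF R] decidable_comp3[OF R'] computable_comp[OF g])

section \<open>Correctness of the stagewise approximations\<close>

definition index_of :: "(bstr \<Rightarrow> bstr option) \<Rightarrow> recf \<Rightarrow> bool" where
  "index_of U e \<longleftrightarrow> (\<forall>\<sigma> \<tau>. U \<sigma> = Some \<tau> \<longleftrightarrow> eval e (code \<sigma>) (code \<tau>))"

lemma index_of_runs: "index_of U e \<Longrightarrow> U \<sigma> = Some \<tau> \<longleftrightarrow> (\<exists>t. runs e t \<sigma> \<tau>)"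
  by (simp add: index_of_def eval_iff_Ev runs_def)

lemma compressed_iff:
  assumes "index_of U e"
  shows "(\<exists>s. compressed e i s \<tau>) \<longleftrightarrow> (\<exists>\<sigma>. length \<sigma> \<le> 2 * i \<and> U \<sigma> = Some \<tau>)"
proof
  assume "\<exists>s. compressed e i s \<tau>"
  then show "\<exists>\<sigma>. length \<sigma> \<le> 2 * i \<and> U \<sigma> = Some \<tau>"
    unfolding compressed_def index_of_runs[OF assms] by blast
next
  assume "\<exists>\<sigma>. length \<sigma> \<le> 2 * i \<and> U \<sigma> = Some \<tau>"
  then obtain \<sigma> t where "length \<sigma> \<le> 2 * i" "runs e t \<sigma> \<tau>" unfolding index_of_runs[OF assms] by blast
  then have "compressed e i (Suc (code \<sigma>) + t) \<tau>"
    unfolding compressed_def by (intro exI[of _ \<sigma>]) (auto intro: runs_mono)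
  then show "\<exists>s. compressed e i s \<tau>" ..
qed

text \<open>Block \<open>i\<close> adds \<open>2 * i + 1\<close> bits, giving
  \<open>2 ^ (2 * i + 1)\<close> extensions, one more than there are strings of length at most
  \<open>2 * i\<close> to serve as programs.\<close>

lemma incompressible_extension:
  fixes U :: "bstr \<Rightarrow> bstr option"
  assumes "length \<sigma> = i * i"
  shows "\<exists>\<tau>. length \<tau> = Suc i * Suc i \<and> take (i * i) \<tau> = \<sigma> \<and> \<not> (\<exists>\<rho>. length \<rho> \<le> 2 * i \<and> U \<rho> = Some \<tau>)"
proof (rule ccontr)
  assume "\<not> ?thesis"
  then have all: "\<exists>\<rho>. length \<rho> \<le> 2 * i \<and> U \<rho> = Some \<tau>"
    if "length \<tau> = Suc i * Suc i" "take (i * i) \<tau> = \<sigma>" for \<tau>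
    using that by blast
  let ?S = "{v :: bstr. length v = Suc (2 * i)}" and ?P = "{\<rho> :: bstr. length \<rho> \<le> 2 * i}"
  have card: "card ?S = 2 ^ Suc (2 * i)"
    using card_lists_length_eq[of "UNIV :: bool set" "Suc (2 * i)"] by (simp only: card_UNIV_bool subset_UNIV finite simp_thms)
  have card': "card ?P = (\<Sum>k\<le>2 * i. 2 ^ k)"
    using card_lists_length_le[of "UNIV :: bool set" "2 * i"] by (simp only: card_UNIV_bool subset_UNIV finite simp_thms)
  have fin: "finite ?P"
    using finite_lists_length_le[of "UNIV :: bool set" "2 * i"] by (simp only: subset_UNIV finite simp_thms)
  have "\<exists>\<rho>. length \<rho> \<le> 2 * i \<and> U \<rho> = Some (\<sigma> @ v)" if "v \<in> ?S" for v
    using that assms by (intro all) auto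
  then have "\<forall>v\<in>?S. \<exists>\<rho>. length \<rho> \<le> 2 * i \<and> U \<rho> = Some (\<sigma> @ v)" by blast
  from bchoice[OF this] obtain f where f: "\<And>v. v \<in> ?S \<Longrightarrow> length (f v) \<le> 2 * i \<and> U (f v) = Some (\<sigma> @ v)"
    by blast
  have "inj_on f ?S"
  proof (rule inj_onI)
    fix v w assume v: "v \<in> ?S" and w: "w \<in> ?S" and eq: "f v = f w"
    have "Some (\<sigma> @ v) = Some (\<sigma> @ w)" using f[OF v] f[OF w] unfolding eq by metis
    then show "v = w" by simp
  qed
  moreover have "f ` ?S \<subseteq> ?P" using f by blast
  ultimately have "card ?S \<le> card ?P" using fin by (rule card_inj_on_le)
  moreover have "(\<Sum>k\<le>n. 2 ^ k) < (2 :: nat) ^ Suc n" for n by (induction n) simp_all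
  then have "card ?P < card ?S" unfolding card card' .
  ultimately show False by linarith
qed

text \<open>The conclusion \<open>n \<le> z\<close> ties the length to the witness: codes dominate
  their components and the lengths of the lists they code. It will keep \<open>n\<close> before the
  next active block.\<close>

lemma gap_witness_sound:
  assumes U: "index_of U e"
    and A: "\<And>n. A n \<longleftrightarrow> (\<exists>x. \<forall>y. R n x y)" "\<And>n. \<not> A n \<longleftrightarrow> (\<exists>x. \<forall>y. R' n x y)"
    and z: "\<And>y. gap_witness e R R' g j z y"
  shows "\<exists>n\<le>z. \<exists>\<rho>. U \<rho> = Some (replicate n False) \<and>
    (\<forall>\<pi>. U \<pi> = Some (restr A n) \<longrightarrow> length \<rho> + g j < length \<pi>)"
proof -
  let ?\<sigma> = "str (pfst z)" and ?\<rho> = "str (pfst (psnd z))"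
  let ?t = "pfst (psnd (psnd z))" and ?x = "psnd (psnd (psnd z))"
  have 1: "runs e ?t ?\<rho> (replicate (length ?\<sigma>) False)"
    using z by (simp add: gap_witness_def Let_def)
  have 2: "(bit ?\<sigma> k \<longrightarrow> R k (lnth ?x k) y) \<and> (\<not> bit ?\<sigma> k \<longrightarrow> R' k (lnth ?x k) y)" if "k < length ?\<sigma>" for k y
    using z[of y] that unfolding gap_witness_def Let_def by blast
  have 3: "\<not> runs e y \<pi> ?\<sigma>" if "code \<pi> < y" "length \<pi> \<le> length ?\<rho> + g j" for \<pi> y
    using z[of y] that unfolding gap_witness_def Let_def by blast
  \<comment> \<open>\<open>R\<close> and \<open>R'\<close> cannot both have a witness at
    \<open>k\<close>, so the witness stored in \<open>?x\<close> certifies the guessed bit.\<close>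
  have "bit ?\<sigma> k \<longleftrightarrow> A k" if "k < length ?\<sigma>" for k
    using 2[OF that] A[of k] by blast
  then have \<sigma>: "restr A (length ?\<sigma>) = ?\<sigma>"
    by (intro nth_equalityI) (auto simp: restr_def bit_def)
  have "length ?\<sigma> \<le> pfst z" using length_list_decode by (simp add: str_def)
  also have "pfst z \<le> z" using le_prod_encode_1[of "pfst z" "psnd z"] by simp
  finally have "length ?\<sigma> \<le> z" .
  moreover have "U ?\<rho> = Some (replicate (length ?\<sigma>) False)" unfolding index_of_runs[OF U] using 1 by blast
  moreover have "length ?\<rho> + g j < length \<pi>" if \<pi>: "U \<pi> = Some (restr A (length ?\<sigma>))" for \<pi>
  proof (rule ccontr)
    assume le: "\<not> length ?\<rho> + g j < length \<pi>"
    obtain t where "runs e t \<pi> ?\<sigma>" using \<pi> unfolding index_of_runs[OF U] \<sigma> by blast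
    \<comment> \<open>The stage has to pass both \<open>code \<pi>\<close>, strictly, and the
      running time before the last clause of \<open>gap_witness\<close> rules \<open>\<pi>\<close>
      out.\<close>
    then have "runs e (Suc (code \<pi>) + t) \<pi> ?\<sigma>" by (rule runs_mono) simp
    with 3[of \<pi> "Suc (code \<pi>) + t"] le show False by simp
  qed
  ultimately show ?thesis by blast
qed

text \<open>That the initial segment has no short program is a universal statement about stages, so
  a true gap is never refuted. \<open>list_encode\<close> bundles one witness per bit.\<close>

lemma gap_witness_complete:
  assumes U: "index_of U e"
    and A: "\<And>n. A n \<longleftrightarrow> (\<exists>x. \<forall>y. R n x y)" "\<And>n. \<not> A n \<longleftrightarrow> (\<exists>x. \<forall>y. R' n x y)"
    and \<rho>: "U \<rho> = Some (replicate n False)"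
    and gap: "\<And>\<pi>. U \<pi> = Some (restr A n) \<Longrightarrow> length \<rho> + g j < length \<pi>"
  shows "\<exists>z. \<forall>y. gap_witness e R R' g j z y"
proof -
  obtain t where t: "runs e t \<rho> (replicate n False)" using \<rho> unfolding index_of_runs[OF U] by blast
  have "\<forall>k. \<exists>x. \<forall>y. (A k \<longrightarrow> R k x y) \<and> (\<not> A k \<longrightarrow> R' k x y)" using A by metis
  then obtain f where f: "\<And>k y. (A k \<longrightarrow> R k (f k) y) \<and> (\<not> A k \<longrightarrow> R' k (f k) y)" by metis
  define x where "x = list_encode (map f [0..<n])"
  have x: "lnth x k = f k" if "k < n" for k using that by (simp add: x_def lnth_def)
  have bit: "bit (restr A n) k \<longleftrightarrow> A k" if "k < n" for k using that by (simp add: bit_def restr_def)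
  have "\<not> runs e y \<pi> (restr A n)" if "length \<pi> \<le> length \<rho> + g j" for \<pi> y
    using gap[of \<pi>] that index_of_runs[OF U] by (meson not_less)
  then have "gap_witness e R R' g j (prod_encode (code (restr A n), prod_encode (code \<rho>, prod_encode (t, x)))) y" for y
    using t f x bit by (simp add: gap_witness_def Let_def)
  then show ?thesis by blast
qed

section \<open>Two prefix-free machines\<close>

lemma prefix_unary:
  assumes "prefix (replicate k True @ [False] @ u) (replicate k' True @ [False] @ u')"
  shows "k = k' \<and> prefix u u'"
  using assms
proof (induction k arbitrary: k')
  case 0
  then show ?case by (cases k') auto
next
  case (Suc k)
  then show ?case by (cases k') auto
qed

text \<open>The unary header brings the cost of \<open>\<rho>\<close> to
  \<open>2 * length \<rho> + 1\<close>. This is affordable because a requirement may demand any gap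
  that is computable from its index.\<close>

definition self_delimited :: "bstr \<Rightarrow> bstr \<Rightarrow> bstr" where
  "self_delimited \<rho> \<tau> = replicate (length \<rho>) True @ [False] @ \<rho> @ \<tau>"

lemma prefix_self_delimited:
  assumes "prefix (self_delimited \<rho> \<tau>) (self_delimited \<rho>' \<tau>')"
  shows "\<rho> = \<rho>' \<and> prefix \<tau> \<tau>'"
proof -
  from prefix_unary[OF assms[unfolded self_delimited_def]]
  have "length \<rho> = length \<rho>'" and "prefix (\<rho> @ \<tau>) (\<rho>' @ \<tau>')" by auto
  then show ?thesis by (auto simp: prefix_def)
qed

lemma optimalD:
  assumes "optimal_pf_machine U" and G: "semidecidable (\<lambda>p. G (str (pfst p)) (str (psnd p)))"
    and functional: "\<And>\<sigma> \<tau> \<tau>'. G \<sigma> \<tau> \<Longrightarrow> G \<sigma> \<tau>' \<Longrightarrow> \<tau> = \<tau>'"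
    and pf: "\<And>\<sigma> \<tau> \<sigma>' \<tau>'. G \<sigma> \<tau> \<Longrightarrow> G \<sigma>' \<tau>' \<Longrightarrow> prefix \<sigma> \<sigma>' \<Longrightarrow> \<sigma> = \<sigma>'"
  shows "\<exists>c. \<forall>\<sigma> \<tau>. G \<sigma> \<tau> \<longrightarrow> (\<exists>\<sigma>'. U \<sigma>' = Some \<tau> \<and> length \<sigma>' \<le> length \<sigma> + c)"
proof -
  have "\<exists>M. partial_computable_str M \<and> (\<forall>\<sigma> \<tau>. M \<sigma> = Some \<tau> \<longleftrightarrow> G \<sigma> \<tau>)"
    using G functional by (rule partial_computable_str_if_semidecidable)
  then obtain M where M: "partial_computable_str M" "\<And>\<sigma> \<tau>. M \<sigma> = Some \<tau> \<longleftrightarrow> G \<sigma> \<tau>" by blast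
  have "prefix_free_machine M"
    unfolding prefix_free_machine_def
  proof (intro conjI M(1) allI impI)
    fix \<sigma> \<sigma>' assume "\<sigma> \<in> dom M" "\<sigma>' \<in> dom M" "prefix \<sigma> \<sigma>'"
    then show "\<sigma> = \<sigma>'" using M(2) pf by (auto simp: dom_def)
  qed
  with assms(1) M(2) show ?thesis unfolding optimal_pf_machine_def by metis
qed

text \<open>The machine whose only program is the empty string, with output \<open>\<tau>\<close>,
  is prefix-free. The lemma ensures that the \<open>LEAST\<close> in \<open>KC\<close> is
  attained.\<close>

lemma optimal_surj:
  assumes "optimal_pf_machine U"
  shows "\<exists>\<sigma>. U \<sigma> = Some \<tau>"
proof -
  have "semidecidable (\<lambda>p. str (pfst p) = [] \<and> str (psnd p) = \<tau>)"
    by (intro semidecidable_decidable scomp_intros)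
  from optimalD[OF assms, of "\<lambda>\<sigma> \<rho>. \<sigma> = [] \<and> \<rho> = \<tau>", OF this]
  show ?thesis by blast
qed

lemma KC_le: "U \<sigma> = Some \<tau> \<Longrightarrow> KC U \<tau> \<le> length \<sigma>"
  unfolding KC_def by (rule Least_le) blast

lemma KC_attained:
  assumes "optimal_pf_machine U"
  obtains \<sigma> where "U \<sigma> = Some \<tau>" "length \<sigma> = KC U \<tau>"
proof -
  have "\<exists>l \<sigma>. U \<sigma> = Some \<tau> \<and> length \<sigma> = l" using optimal_surj[OF assms] by blast
  from LeastI_ex[OF this] show ?thesis using that unfolding KC_def by blast
qed

text \<open>The unary strings \<open>1^i 0\<close> form a prefix-free set of programs for the block
  boundaries.\<close>

lemma KC_square_zeros:
  assumes "optimal_pf_machine U"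
  shows "\<exists>c. \<forall>i. KC U (replicate (i * i) False) \<le> Suc i + c"
proof -
  define G where "G = (\<lambda>\<sigma> \<tau>. \<exists>i. \<sigma> = replicate i True @ [False] \<and> \<tau> = replicate (i * i) False)"
  have inj: "i = i'" if "prefix (replicate i True @ [False]) (replicate i' True @ [False])" for i i'
    using prefix_unary[of i "[]" i' "[]"] that by simp
  have "semidecidable (\<lambda>p. G (str (pfst p)) (str (psnd p)))"
    unfolding G_def by (intro semidecidable_ex semidecidable_decidable scomp_intros)
  moreover have "\<tau> = \<tau>'" if "G \<sigma> \<tau>" "G \<sigma> \<tau>'" for \<sigma> \<tau> \<tau>'
    using that inj unfolding G_def by (metis prefix_order.refl)
  moreover have "\<sigma> = \<sigma>'" if "G \<sigma> \<tau>" "G \<sigma>' \<tau>'" "prefix \<sigma> \<sigma>'" for \<sigma> \<tau> \<sigma>' \<tau>'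
    using that inj unfolding G_def by metis
  ultimately have "\<exists>c. \<forall>\<sigma> \<tau>. G \<sigma> \<tau> \<longrightarrow> (\<exists>\<sigma>'. U \<sigma>' = Some \<tau> \<and> length \<sigma>' \<le> length \<sigma> + c)"
    by (rule optimalD[OF assms])
  then obtain c where c: "\<And>\<sigma> \<tau>. G \<sigma> \<tau> \<Longrightarrow> \<exists>\<sigma>'. U \<sigma>' = Some \<tau> \<and> length \<sigma>' \<le> length \<sigma> + c" by blast
  have "KC U (replicate (i * i) False) \<le> Suc i + c" for i
  proof -
    have "G (replicate i True @ [False]) (replicate (i * i) False)" unfolding G_def by blast
    from c[OF this] obtain \<sigma>' where \<sigma>': "U \<sigma>' = Some (replicate (i * i) False)"
      "length \<sigma>' \<le> length (replicate i True @ [False]) + c" by blast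
    from KC_le[of U, OF \<sigma>'(1)] \<sigma>'(2) show ?thesis by simp
  qed
  then show ?thesis by blast
qed

text \<open>From the initial segment of a path that ends with the active block \<open>j\<close>, together with a program
  for \<open>0\<^sup>n\<close>, the machine recovers the first \<open>n\<close> bits, provided all later blocks up to \<open>n\<close> are frozen.\<close>

definition follow :: "recf \<Rightarrow> (nat \<Rightarrow> nat \<Rightarrow> bool) \<Rightarrow> (nat \<Rightarrow> nat \<Rightarrow> bstr \<Rightarrow> bool) \<Rightarrow> bstr \<Rightarrow> bstr \<Rightarrow> bool" where
  "follow e C V \<sigma> \<upsilon> \<longleftrightarrow> (\<exists>\<rho> \<tau> \<omega> n j m t. length \<rho> = Suc j * Suc j \<and> \<sigma> = self_delimited \<rho> \<tau> \<and>
     runs e t \<tau> (replicate n False) \<and> length \<omega> = m * m \<and> j < m \<and> take (length \<rho>) \<omega> = \<rho> \<and> n \<le> length \<omega> \<and>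
     (\<forall>i<m. j < i \<longrightarrow> (\<exists>d<t. frozen C V i d (take (Suc i * Suc i) \<omega>))) \<and> \<upsilon> = take n \<omega>)"

lemma semidecidable_follow:
  assumes C: "decidable (\<lambda>p. C (pfst p) (psnd p))"
    and V: "decidable (\<lambda>p. V (pfst p) (pfst (psnd p)) (str (psnd (psnd p))))"
  shows "semidecidable (\<lambda>p. follow e C V (str (pfst p)) (str (psnd p)))"
  unfolding follow_def self_delimited_def
  by (intro semidecidable_ex_str semidecidable_ex semidecidable_decidable scomp_intros decidable_runs
      decidable_frozen C V)

lemma square_inject: "Suc i * Suc i = Suc j * Suc j \<Longrightarrow> i = j"
  by (metis power2_eq_iff_nonneg power2_eq_square nat.inject zero_le)

text \<open>One statement covers functionality, with \<open>\<sigma> = \<sigma>'\<close>, and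
  prefix-freeness. The header yields the same \<open>\<rho>\<close>; comparable programs of
  \<open>U\<close> coincide, which yields the same \<open>n\<close>; the guessed strings then agree
  as far as both are frozen.\<close>

lemma follow_cong:
  assumes U: "index_of U e" and pf: "prefix_free_machine U"
    and "follow e C V \<sigma> \<upsilon>" "follow e C V \<sigma>' \<upsilon>'" "prefix \<sigma> \<sigma>'"
  shows "\<sigma> = \<sigma>' \<and> \<upsilon> = \<upsilon>'"
proof -
  from assms(3) obtain \<rho> \<tau> \<omega> n j m t where 1: "length \<rho> = Suc j * Suc j" "\<sigma> = self_delimited \<rho> \<tau>"
     "runs e t \<tau> (replicate n False)" "length \<omega> = m * m" "j < m" "take (length \<rho>) \<omega> = \<rho>" "n \<le> length \<omega>"
     "\<forall>i<m. j < i \<longrightarrow> (\<exists>d<t. frozen C V i d (take (Suc i * Suc i) \<omega>))" "\<upsilon> = take n \<omega>"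
    unfolding follow_def by (elim exE conjE)
  from assms(4) obtain \<rho>' \<tau>' \<omega>' n' j' m' t' where 2: "length \<rho>' = Suc j' * Suc j'" "\<sigma>' = self_delimited \<rho>' \<tau>'"
     "runs e t' \<tau>' (replicate n' False)" "length \<omega>' = m' * m'" "j' < m'" "take (length \<rho>') \<omega>' = \<rho>'" "n' \<le> length \<omega>'"
     "\<forall>i<m'. j' < i \<longrightarrow> (\<exists>d<t'. frozen C V i d (take (Suc i * Suc i) \<omega>'))" "\<upsilon>' = take n' \<omega>'"
    unfolding follow_def by (elim exE conjE)
  from prefix_self_delimited assms(5) have \<rho>: "\<rho> = \<rho>'" and "prefix \<tau> \<tau>'" unfolding 1(2) 2(2) by blast+
  have dom: "U \<tau> = Some (replicate n False)" "U \<tau>' = Some (replicate n' False)"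
    using 1(3) 2(3) index_of_runs[OF U] by blast+
  with pf \<open>prefix \<tau> \<tau>'\<close> have \<tau>: "\<tau> = \<tau>'" unfolding prefix_free_machine_def by blast
  have "replicate n False = replicate n' False" using dom \<tau> by simp
  then have n: "n = n'" by (metis length_replicate)
  have j: "j = j'" using 1(1) 2(1) \<rho> square_inject by metis
  \<comment> \<open>The guesses may have different lengths, but each reaches \<open>n\<close>, so
    the shorter one does.\<close>
  define l where "l = min m m'"
  have "take (l * l) \<omega> = take (l * l) \<omega>'"
  proof (rule frozen_blocks_unique[where j = "Suc j"])
    show "\<exists>d. frozen C V i d (take (Suc i * Suc i) \<omega>)" if "Suc j \<le> i" "i < m" for i
      using 1(8) that by (meson Suc_le_lessD)
    show "\<exists>d. frozen C V i d (take (Suc i * Suc i) \<omega>')" if "Suc j \<le> i" "i < m'" for i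
      using 2(8) that j by (meson Suc_le_lessD)
    show "take (Suc j * Suc j) \<omega> = take (Suc j * Suc j) \<omega>'" using 1(1,6) 2(6) \<rho> by metis
    show "Suc j \<le> l" using 1(5) 2(5) j by (simp add: l_def)
  qed (use 1(4) 2(4) in \<open>auto simp: l_def\<close>)
  moreover have "n \<le> l * l" using 1(4,7) 2(4,7) n by (auto simp: l_def min_def)
  ultimately have "take n \<omega> = take n \<omega>'" by (metis min.absorb1 take_take)
  then show ?thesis using 1(2,9) 2(2,9) \<rho> \<tau> n by simp
qed

text \<open>The path itself, cut off before block \<open>i\<close>, is a correct guess: every block
  after \<open>j\<close> and before \<open>i\<close> gets deactivated and is therefore frozen on
  it.\<close>

lemma follow_path:
  assumes U: "index_of U e" and X: "X \<in> paths (block_tree C V)"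
    and "j < i" "\<And>k. j < k \<Longrightarrow> k < i \<Longrightarrow> \<exists>s. \<not> active C s k"
    and \<tau>: "U \<tau> = Some (replicate n False)" and "n \<le> i * i"
  shows "follow e C V (self_delimited (restr X (Suc j * Suc j)) \<tau>) (restr X n)"
proof -
  obtain t where t: "runs e t \<tau> (replicate n False)" using \<tau> index_of_runs[OF U] by blast
  have adm: "admissible C V k s (restr X (Suc k * Suc k))" for k s
    using X unfolding paths_block_tree by blast
  have "\<forall>k. \<exists>d. j < k \<longrightarrow> k < i \<longrightarrow> frozen C V k d (restr X (Suc k * Suc k))"
  proof (intro allI)
    fix k
    show "\<exists>d. j < k \<longrightarrow> k < i \<longrightarrow> frozen C V k d (restr X (Suc k * Suc k))"
    proof (cases "j < k \<and> k < i")
      case True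
      then obtain s where "\<not> active C s k" using assms(4) by blast
      from frozen_exists[of C s k V, OF this adm] show ?thesis by blast
    qed auto
  qed
  then obtain d where d: "\<And>k. j < k \<Longrightarrow> k < i \<Longrightarrow> frozen C V k (d k) (restr X (Suc k * Suc k))" by metis
  \<comment> \<open>A single bound for the running time and for all freezing stages
    \<open>d k\<close>, the latter strictly.\<close>
  define t' where "t' = Suc (t + sum d {..<i})"
  have dk: "d k < t'" if "k < i" for k
  proof -
    have "d k \<le> sum d {..<i}" using that by (intro member_le_sum) auto
    then show ?thesis by (simp add: t'_def)
  qed
  have le: "Suc k * Suc k \<le> i * i" if "k < i" for k
    using that by (intro mult_le_mono) auto
  have tk: "take (Suc k * Suc k) (restr X (i * i)) = restr X (Suc k * Suc k)" if "k < i" for k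
    using le[OF that] by (simp only: take_restr min_absorb1)
  show ?thesis
    unfolding follow_def
  proof (intro exI conjI allI impI)
    show "runs e t' \<tau> (replicate n False)" using t by (rule runs_mono) (simp add: t'_def)
    show "take (length (restr X (Suc j * Suc j))) (restr X (i * i)) = restr X (Suc j * Suc j)"
      using tk[OF assms(3)] by simp
    show "restr X n = take n (restr X (i * i))" using assms(6) by (simp add: take_restr min_absorb1)
    show "j < i" by fact
    show "d k < t'" if "k < i" for k using dk[OF that] .
    show "frozen C V k (d k) (take (Suc k * Suc k) (restr X (i * i)))" if "k < i" "j < k" for k
      using d[OF that(2,1)] tk[OF that(1)] by simp
  qed (use assms(6) in simp_all)
qed

text \<open>The constant is fixed before \<open>X\<close> and \<open>j\<close>, which later allows
  \<open>j\<close> to be chosen above it. The term \<open>Suc (2 * (Suc j * Suc j))\<close> pays for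
  the self-delimited initial segment through block \<open>j\<close>.\<close>

lemma KC_path:
  assumes "optimal_pf_machine U" "index_of U e"
    and C: "decidable (\<lambda>p. C (pfst p) (psnd p))"
    and V: "decidable (\<lambda>p. V (pfst p) (pfst (psnd p)) (str (psnd (psnd p))))"
  shows "\<exists>c. \<forall>X\<in>paths (block_tree C V). \<forall>j i \<tau> n. j < i \<longrightarrow> (\<forall>k. j < k \<longrightarrow> k < i \<longrightarrow> (\<exists>s. \<not> active C s k)) \<longrightarrow>
    U \<tau> = Some (replicate n False) \<longrightarrow> n \<le> i * i \<longrightarrow>
    KC U (restr X n) \<le> Suc (2 * (Suc j * Suc j)) + length \<tau> + c"
proof -
  have pf: "prefix_free_machine U" using assms(1) by (simp add: optimal_pf_machine_def)
  have "\<exists>c. \<forall>\<sigma> \<tau>. follow e C V \<sigma> \<tau> \<longrightarrow> (\<exists>\<sigma>'. U \<sigma>' = Some \<tau> \<and> length \<sigma>' \<le> length \<sigma> + c)"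
  proof (rule optimalD[OF assms(1)])
    show "semidecidable (\<lambda>p. follow e C V (str (pfst p)) (str (psnd p)))"
      by (rule semidecidable_follow[OF C V])
  qed (use follow_cong[OF assms(2) pf] in blast)+
  then obtain c where c: "\<And>\<sigma> \<tau>. follow e C V \<sigma> \<tau> \<Longrightarrow> \<exists>\<sigma>'. U \<sigma>' = Some \<tau> \<and> length \<sigma>' \<le> length \<sigma> + c" by blast
  have "KC U (restr X n) \<le> Suc (2 * (Suc j * Suc j)) + length \<tau> + c"
    if "X \<in> paths (block_tree C V)" "j < i" "\<forall>k. j < k \<longrightarrow> k < i \<longrightarrow> (\<exists>s. \<not> active C s k)"
      "U \<tau> = Some (replicate n False)" "n \<le> i * i" for X j i \<tau> n
  proof -
    have "follow e C V (self_delimited (restr X (Suc j * Suc j)) \<tau>) (restr X n)"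
      using that by (intro follow_path[OF assms(2)]) auto
    from c[OF this] obtain \<sigma>' where \<sigma>': "U \<sigma>' = Some (restr X n)"
      "length \<sigma>' \<le> length (self_delimited (restr X (Suc j * Suc j)) \<tau>) + c" by blast
    from KC_le[of U, OF \<sigma>'(1)] \<sigma>'(2) show ?thesis by (simp add: self_delimited_def)
  qed
  then show ?thesis by blast
qed

section \<open>The class\<close>

lemma decidable_rel3:
  assumes "computable_rel3 R"
  shows "decidable (\<lambda>p. R (pfst p) (pfst (psnd p)) (psnd (psnd p)))"
proof -
  from assms obtain e where "\<And>n x y. eval e (prod_encode (n, prod_encode (x, y))) (if R n x y then 1 else 0)"
    unfolding computable_rel3_def by blast
  from this[of "pfst p" "pfst (psnd p)" "psnd (psnd p)" for p] show ?thesis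
    unfolding decidable_def computable_def by (intro exI[of _ e] allI) simp
qed

lemma restr_empty_set_seq: "restr empty_set_seq n = replicate n False"
  by (simp add: restr_def empty_set_seq_def map_replicate_const)

theorem theorem6p1:
  fixes U :: "bstr \<Rightarrow> bstr option" and A :: "nat \<Rightarrow> bool"
  assumes "optimal_pf_machine U"
    and "Delta02 A"
    and "\<not> leK U A empty_set_seq"
  shows "\<exists>P. Pi01_class P \<and> P \<noteq> {} \<and>
           (\<forall>X\<in>P. \<not> leK U X empty_set_seq \<and> \<not> leK U A X)"
proof -
  note opt = assms(1)
  obtain e where e: "index_of U e"
    using opt unfolding optimal_pf_machine_def prefix_free_machine_def partial_computable_str_def index_of_def
    by blast
  obtain R R' where R: "computable_rel3 R" "\<And>n. A n \<longleftrightarrow> (\<exists>x. \<forall>y. R n x y)"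
    and R': "computable_rel3 R'" "\<And>n. \<not> A n \<longleftrightarrow> (\<exists>x. \<forall>y. R' n x y)"
    using assms(2) unfolding Delta02_def Pi02_def Sigma02_def by blast
  \<comment> \<open>The cost of the initial segment in \<open>KC_path\<close>, plus a surplus
    \<open>j\<close> that will outgrow all constants.\<close>
  define g where "g = (\<lambda>j. Suc (2 * (Suc j * Suc j)) + j)"
  define W where "W = gap_witness e R R' g"
  define C where "C = acts W"
  define V where "V = compressed e"
  have W: "\<exists>z. \<forall>y. W j z y" for j
  proof -
    obtain n where n: "KC U (restr A n) > KC U (replicate n False) + g j"
      using assms(3) unfolding leK_def restr_empty_set_seq by (meson not_le)
    obtain \<rho> where \<rho>: "U \<rho> = Some (replicate n False)" "length \<rho> = KC U (replicate n False)"
      by (rule KC_attained[OF opt])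
    have "length \<rho> + g j < length \<pi>" if "U \<pi> = Some (restr A n)" for \<pi>
      using KC_le[of U, OF that] n \<rho>(2) by linarith
    from gap_witness_complete[of U e A R R' \<rho> n g j, OF e R(2) R'(2) \<rho>(1) this] show ?thesis
      unfolding W_def .
  qed
  have fin: "\<exists>r0. \<forall>r\<ge>r0. \<not> C j r" for j
    unfolding C_def by (rule acts_finite[OF W])
  have "computable g" unfolding g_def by (intro comp_intros)
  then have dC: "decidable (\<lambda>p. C (pfst p) (psnd p))"
    unfolding C_def W_def by (intro decidable_acts decidable_gap_witness decidable_rel3 R(1) R'(1))
  have dV: "decidable (\<lambda>p. V (pfst p) (pfst (psnd p)) (str (psnd (psnd p))))"
    unfolding V_def by (intro decidable_compressed scomp_intros)
  let ?P = "paths (block_tree C V)"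
  have "Pi01_class ?P" by (rule Pi01_class_block_tree[OF dC dV])
  moreover have "?P \<noteq> {}"
  proof (rule paths_block_tree_nonempty)
    show "V i s' \<tau>" if "V i s \<tau>" "s \<le> s'" for i s s' \<tau>
      using that unfolding V_def by (rule compressed_mono)
    show "\<exists>\<tau>. length \<tau> = Suc i * Suc i \<and> take (i * i) \<tau> = \<sigma> \<and> (\<forall>s. \<not> V i s \<tau>)"
      if "length \<sigma> = i * i" for i \<sigma>
      using incompressible_extension[OF that, of U] compressed_iff[OF e] unfolding V_def by blast
  qed
  moreover have "\<not> leK U X empty_set_seq" if X: "X \<in> ?P" for X
  proof
    assume "leK U X empty_set_seq"
    then obtain c where c: "\<And>n. KC U (restr X n) \<le> KC U (replicate n False) + c"
      unfolding leK_def restr_empty_set_seq by blast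
    obtain c' where c': "\<And>i. KC U (replicate (i * i) False) \<le> Suc i + c'"
      using KC_square_zeros[OF opt] by blast
    \<comment> \<open>The estimates combine to \<open>2 * i < i + 2 + c + c'\<close>, which fails
      for such \<open>i\<close>.\<close>
    obtain i where i: "i \<ge> c + c' + 3" "\<And>s. active C s i"
      using infinite_active[of C "c + c' + 3", OF fin] by blast
    have "\<not> V i s (restr X (Suc i * Suc i))" for s
      using X i(2) unfolding paths_block_tree admissible_def by blast
    then have incompressible: "\<not> (\<exists>\<sigma>. length \<sigma> \<le> 2 * i \<and> U \<sigma> = Some (restr X (Suc i * Suc i)))"
      using compressed_iff[OF e] unfolding V_def by blast
    obtain \<sigma> where "U \<sigma> = Some (restr X (Suc i * Suc i))" "length \<sigma> = KC U (restr X (Suc i * Suc i))"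
      by (rule KC_attained[OF opt])
    with incompressible have "2 * i < KC U (restr X (Suc i * Suc i))" by (metis not_le)
    with c[of "Suc i * Suc i"] c'[of "Suc i"] i(1) show False by linarith
  qed
  moreover have "\<not> leK U A X" if X: "X \<in> ?P" for X
  proof
    assume "leK U A X"
    then obtain c where c: "\<And>n. KC U (restr A n) \<le> KC U (restr X n) + c" unfolding leK_def by blast
    obtain c' where c': "\<And>j i \<tau> n. j < i \<Longrightarrow> (\<forall>k. j < k \<longrightarrow> k < i \<longrightarrow> (\<exists>s. \<not> active C s k)) \<Longrightarrow>
        U \<tau> = Some (replicate n False) \<Longrightarrow> n \<le> i * i \<Longrightarrow>
        KC U (restr X n) \<le> Suc (2 * (Suc j * Suc j)) + length \<tau> + c'"
      using KC_path[OF opt e dC dV] X by blast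
    \<comment> \<open>The surplus \<open>j\<close> in \<open>g j\<close> now absorbs the constant of
      the assumed reduction and that of the machine.\<close>
    obtain j where j: "j \<ge> c + c'" "\<And>s. active C s j"
      using infinite_active[of C "c + c'", OF fin] by blast
    obtain i where i: "j < i" "\<forall>r\<ge>i. \<not> C j r" "\<forall>k. j < k \<longrightarrow> k < i \<longrightarrow> (\<exists>s. \<not> active C s k)"
      using next_active[of C j, OF j(2) fin] by blast
    \<comment> \<open>Requirement \<open>j\<close> is quiet from stage \<open>i\<close> on, so its
      guess has converged to some \<open>z \<le> i\<close>; hence
      \<open>n \<le> z \<le> i \<le> i * i\<close> lies within the stretch determined by block
      \<open>j\<close>.\<close>
    have "\<exists>z\<le>i. \<forall>y. W j z y" by (rule acts_stable) (use i(2) in \<open>simp add: C_def\<close>)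
    then obtain z where z: "z \<le> i" "\<And>y. gap_witness e R R' g j z y" unfolding W_def by blast
    obtain n \<rho> where n: "n \<le> z" and \<rho>: "U \<rho> = Some (replicate n False)"
      and gap: "\<And>\<pi>. U \<pi> = Some (restr A n) \<Longrightarrow> length \<rho> + g j < length \<pi>"
      using gap_witness_sound[of U e A R R' g j z, OF e R(2) R'(2) z(2)] by blast
    obtain \<pi> where \<pi>: "U \<pi> = Some (restr A n)" "length \<pi> = KC U (restr A n)" by (rule KC_attained[OF opt])
    have "n \<le> i * i" using n z(1) le_square[of i] by linarith
    from c'[OF i(1,3) \<rho> this] have "KC U (restr X n) \<le> Suc (2 * (Suc j * Suc j)) + length \<rho> + c'" .
    moreover have "length \<rho> + (Suc (2 * (Suc j * Suc j)) + j) < KC U (restr A n)"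
      using gap[OF \<pi>(1)] \<pi>(2) by (simp only: g_def)
    ultimately show False using c[of n] j(1) by linarith
  qed
  ultimately show ?thesis by blast
qed

end
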